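(* The following hold. (a) If $w$ is a word in which no letter appears both at an odd index and at an even index, then $w$ is $d$-stackable for every positive integer $d$. (b) If $w$ is $d$-stackable and $k$ is a positive integer, then the word $w'$ obtained from $w$ by repeating each letter $k$ times consecutively (e.g. $\mathsf{AABC}$ becomes $\mathsf{AAAABBCC}$ for $k=2$) is $d$-stackable. (c) If $w$ is a word with at most four characters, then $w$ is $2$-stackable if and only if $w$ is not of the form $\mathsf{A}\mathsf{B}\mathsf{B}\mathsf{B}$ or $\mathsf{B}\mathsf{B}\mathsf{B}\mathsf{A}$ for some distinct letters $\mathsf A,\mathsf B$. (d) For every integer $\ell>3$, the word $\mathsf{A}\mathsf{B}^{\ell-1}$ (one $\mathsf A$ followed by $\ell-1$ copies of a distinct letter $\mathsf B$) is not $2$-stackable.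
   Context: A word is a finite string $w=w_0w_1\cdots w_{\ell-1}$ of letters from some alphabet; words are assumed to contain at least two distinct letters. A $d$-dimensional grid $\Gamma$ of shape $G=\prod_{i=1}^d\mathbb Z/n_i\mathbb Z$ ($n_i$ positive integers) is a map $\Gamma\colon G\to\Sigma$ to an alphabet; its size is $|G|$. An appearance of $w$ in $\Gamma$ is a pair $(p,\mathbf v)\in G\times(\{-1,0,1\}^d\setminus\{\mathbf 0\})$ with $\Gamma(p+i\mathbf v)=w_i$ for all $0\le i<\ell$. The concentration $c_d(w,\Gamma)$ is the number of appearances divided by $|G|$, and $C_d(w)$ is the supremum of $c_d(w,\Gamma)$ over all $d$-dimensional grids. A word $w$ is called $d$-stackable if $C_d(w)=3^{d-1}C_1(w)$. *)

theory Defs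
  imports Complex_Main "HOL-Library.FuncSet"
begin

definition is_word :: "'a list \<Rightarrow> bool" where
  "is_word w \<longleftrightarrow> (\<exists>a\<in>set w. \<exists>b\<in>set w. a \<noteq> b)"

text \<open>
  The group \<open>\<Prod>i<d. \<int>/n\<^sub>i\<int>\<close>, each factor represented by its least nonnegative residues;
  coordinates are indexed from \<open>0\<close>.
\<close>

definition torus :: "nat \<Rightarrow> (nat \<Rightarrow> nat) \<Rightarrow> (nat \<Rightarrow> int) set" where
  "torus d n = (\<Pi>\<^sub>E i\<in>{..<d}. {0..<int (n i)})"

text \<open>
  Directions are integer vectors, not elements of the torus: they stay distinct even when they
  become equal modulo small \<open>n\<^sub>i\<close>.
\<close>

definition directions :: "nat \<Rightarrow> (nat \<Rightarrow> int) set" where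
  "directions d = (\<Pi>\<^sub>E i\<in>{..<d}. {-1, 0, 1}) - {\<lambda>i\<in>{..<d}. 0}"

definition walk :: "nat \<Rightarrow> (nat \<Rightarrow> nat) \<Rightarrow> (nat \<Rightarrow> int) \<Rightarrow> (nat \<Rightarrow> int) \<Rightarrow> nat \<Rightarrow> (nat \<Rightarrow> int)" where
  "walk d n p v i = (\<lambda>j\<in>{..<d}. (p j + int i * v j) mod int (n j))"

text \<open>A grid of shape \<open>torus d n\<close> is a function \<open>\<Gamma>\<close>, of which only the values on the torus matter.\<close>

definition appearances ::
    "nat \<Rightarrow> (nat \<Rightarrow> nat) \<Rightarrow> ((nat \<Rightarrow> int) \<Rightarrow> 'a) \<Rightarrow> 'a list \<Rightarrow> ((nat \<Rightarrow> int) \<times> (nat \<Rightarrow> int)) set" where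
  "appearances d n \<Gamma> w =
     {(p, v) \<in> torus d n \<times> directions d. \<forall>i<length w. \<Gamma> (walk d n p v i) = w ! i}"

definition grid_concentration ::
    "nat \<Rightarrow> (nat \<Rightarrow> nat) \<Rightarrow> ((nat \<Rightarrow> int) \<Rightarrow> 'a) \<Rightarrow> 'a list \<Rightarrow> real" where
  "grid_concentration d n \<Gamma> w = real (card (appearances d n \<Gamma> w)) / real (card (torus d n))"

definition grid_concentrations :: "nat \<Rightarrow> 'a list \<Rightarrow> real set" where
  "grid_concentrations d w = {grid_concentration d n \<Gamma> w | n \<Gamma>. \<forall>i<d. 0 < n i}"

definition concentration :: "nat \<Rightarrow> 'a list \<Rightarrow> real" where
  "concentration d w = Sup (grid_concentrations d w)"

definition stackable :: "nat \<Rightarrow> 'a list \<Rightarrow> bool" where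
  "stackable d w \<longleftrightarrow> concentration d w = 3 ^ (d - 1) * concentration 1 w"

definition repeat_letters :: "nat \<Rightarrow> 'a list \<Rightarrow> 'a list" where
  "repeat_letters k w = concat (map (replicate k) w)"

text \<open>The supremum defining \<^const>\<open>concentration\<close> is over a nonempty set that is bounded above.\<close>

lemma grid_concentrations_nonempty: "grid_concentrations d w \<noteq> {}"
  unfolding grid_concentrations_def by (auto intro: exI[of _ "\<lambda>_. 1"])

lemma finite_torus: "finite (torus d n)"
  unfolding torus_def by (intro finite_PiE) auto

lemma finite_directions: "finite (directions d)"
  unfolding directions_def by (intro finite_Diff finite_PiE) auto

lemma grid_concentration_le: "grid_concentration d n \<Gamma> w \<le> real (card (directions d))"
proof -
  have "card (appearances d n \<Gamma> w) \<le> card (torus d n \<times> directions d)"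
    by (rule card_mono) (auto simp: appearances_def finite_torus finite_directions)
  then have "real (card (appearances d n \<Gamma> w)) \<le> real (card (directions d)) * real (card (torus d n))"
    by (simp add: card_cartesian_product mult.commute flip: of_nat_mult)
  then show ?thesis
    by (cases "card (torus d n) = 0") (simp_all add: grid_concentration_def field_simps)
qed

lemma grid_concentrations_bdd_above: "bdd_above (grid_concentrations d w)"
  unfolding grid_concentrations_def by (rule bdd_aboveI) (auto intro: grid_concentration_le)

end

theory Submission
  imports Defs "HOL-Combinatorics.Cycles"
begin

text \<open>
  Extending a one-dimensional grid constantly in the other directions shows that
  \<open>C\<^sub>d(w) \<ge> 3\<^sup>d\<^sup>-\<^sup>1 C\<^sub>1(w)\<close>, so stackability is an upper bound on \<open>C\<^sub>d(w)\<close>.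

  (a) An appearance only uses edges of the king graph between odd and even letters. Cutting each
  line at the remaining edges and folding the pieces into closed walks shows that there are at most
  \<open>C\<^sub>1(w)\<close> appearances per cut edge, and a cut has at most \<open>3\<^sup>d\<^sup>-\<^sup>1\<close> edges per cell because the
  convolution with the \<open>3 \<times> \<dots> \<times> 3\<close> box has no eigenvalue below \<open>-3\<^sup>d\<^sup>-\<^sup>1\<close>.

  (b) The cells at distances divisible by \<open>k\<close> form grids in which each appearance of the stretched
  word leaves \<open>k\<close> appearances of the original one.

  (c) By reversal and identification of letters, everything reduces to \<open>AAB\<close> and \<open>AABC\<close>, which
  are handled by linear programming duality on \<open>3 \<times> 3\<close> windows.

  (d) In one dimension the concentration is at most \<open>2/\<ell>\<close>. Placing \<open>A\<close> on a plane lattice of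
  index \<open>m\<close> coprime to 6 with \<open>\<ell> \<le> m < 4\<ell>/3\<close> makes all 8 directions from every \<open>A\<close> appearances; only
  \<open>\<ell> = 8\<close> admits no such \<open>m\<close>.
\<close>

section \<open>Words and their periods\<close>

definition spells :: "(nat \<Rightarrow> 'a) \<Rightarrow> 'a list \<Rightarrow> bool" where
  "spells f w \<longleftrightarrow> (\<forall>i<length w. f i = w ! i)"

lemma spells_nth: "spells f w \<Longrightarrow> i < length w \<Longrightarrow> f i = w ! i"
  by (simp add: spells_def)

lemma spells_appendD: "spells f (u @ w) \<Longrightarrow> spells f u"
  by (auto simp: spells_def nth_append)

lemma spells_map: "spells f w \<Longrightarrow> spells (\<lambda>i. h (f i)) (map h w)"
  by (simp add: spells_def)

lemma spells_eq_length_imp_eq: "spells f u \<Longrightarrow> spells f w \<Longrightarrow> length u = length w \<Longrightarrow> u = w"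
  by (simp add: spells_def nth_equalityI)

lemma spells_revI:
  assumes "spells f w" "\<And>i. i < length w \<Longrightarrow> g i = f (length w - Suc i)"
  shows "spells g (rev w)"
  using assms by (simp add: spells_def rev_nth)

definition has_period :: "'a list \<Rightarrow> nat \<Rightarrow> bool" where
  "has_period w \<delta> \<longleftrightarrow> (\<forall>i. i + \<delta> < length w \<longrightarrow> w ! i = w ! (i + \<delta>))"

lemma has_periodI_spells:
  assumes "spells f w" "spells g w" "\<And>i. f i = g (i + \<delta>)"
  shows "has_period w \<delta>"
  unfolding has_period_def using assms by (metis add_lessD1 spells_nth)

lemma is_word_no_period_1:
  assumes "is_word w"
  shows "\<not> has_period w 1"
proof
  assume period_1: "has_period w 1"
  have "w ! i = w ! 0" if "i < length w" for i
    using that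
  proof (induction i)
    case (Suc i)
    then show ?case using period_1 by (metis Suc_eq_plus1 Suc_lessD has_period_def)
  qed simp
  then show False using assms by (metis in_set_conv_nth is_word_def)
qed

lemma is_word_length: "is_word w \<Longrightarrow> 2 \<le> length w"
  using is_word_no_period_1[of w] by (auto simp: has_period_def)

section \<open>The torus\<close>

definition translate ::
    "nat \<Rightarrow> (nat \<Rightarrow> nat) \<Rightarrow> (nat \<Rightarrow> int) \<Rightarrow> (nat \<Rightarrow> int) \<Rightarrow> nat \<Rightarrow> int" where
  "translate d n p u = (\<lambda>j\<in>{..<d}. (p j + u j) mod int (n j))"

definition opposite :: "nat \<Rightarrow> (nat \<Rightarrow> int) \<Rightarrow> nat \<Rightarrow> int" where
  "opposite d v = (\<lambda>j\<in>{..<d}. - v j)"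

definition starts ::
    "nat \<Rightarrow> (nat \<Rightarrow> nat) \<Rightarrow> ((nat \<Rightarrow> int) \<Rightarrow> 'a) \<Rightarrow> 'a list \<Rightarrow> (nat \<Rightarrow> int) \<Rightarrow> (nat \<Rightarrow> int) set" where
  "starts d n \<Gamma> w v = {p \<in> torus d n. spells (\<lambda>i. \<Gamma> (walk d n p v i)) w}"

lemma card_torus: "card (torus d n) = (\<Prod>i<d. n i)"
  by (simp add: torus_def card_PiE)

lemma torus_coordinate: "p \<in> torus d n \<Longrightarrow> j < d \<Longrightarrow> 0 \<le> p j \<and> p j < int (n j)"
  by (auto simp: torus_def PiE_iff)

lemma opposite_apply: "j < d \<Longrightarrow> opposite d v j = - v j"
  by (simp add: opposite_def)

lemma opposite_opposite: "v \<in> directions d \<Longrightarrow> opposite d (opposite d v) = v"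
  by (rule ext) (auto simp: opposite_def directions_def PiE_iff extensional_def)

lemma opposite_in_directions:
  assumes "v \<in> directions d"
  shows "opposite d v \<in> directions d"
proof -
  have "opposite d v \<noteq> (\<lambda>i\<in>{..<d}. 0)"
  proof
    assume "opposite d v = (\<lambda>i\<in>{..<d}. 0)"
    then have "opposite d (opposite d v) = (\<lambda>i\<in>{..<d}. 0)"
      by (simp add: opposite_def restrict_def fun_eq_iff)
    then show False using assms by (simp add: opposite_opposite) (simp add: directions_def)
  qed
  moreover have "opposite d v \<in> (\<Pi>\<^sub>E i\<in>{..<d}. {-1, 0, 1})"
    using assms by (fastforce simp: directions_def opposite_def PiE_iff)
  ultimately show ?thesis by (simp add: directions_def)
qed

lemma bij_betw_opposite: "bij_betw (opposite d) (directions d) (directions d)"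
  by (rule bij_betwI[where g = "opposite d"]) (auto simp: opposite_in_directions opposite_opposite)

lemma finite_starts: "finite (starts d n \<Gamma> w v)"
  by (simp add: starts_def finite_torus)

lemma mem_appearances:
  "(p, v) \<in> appearances d n \<Gamma> w \<longleftrightarrow> v \<in> directions d \<and> p \<in> starts d n \<Gamma> w v"
  by (auto simp: appearances_def starts_def spells_def)

lemma finite_appearances: "finite (appearances d n \<Gamma> w)"
  by (rule finite_subset[of _ "torus d n \<times> directions d"])
     (auto simp: appearances_def finite_torus finite_directions)

lemma card_appearances: "card (appearances d n \<Gamma> w) = (\<Sum>v\<in>directions d. card (starts d n \<Gamma> w v))"
proof -
  have "appearances d n \<Gamma> w = prod.swap ` (SIGMA v:directions d. starts d n \<Gamma> w v)"
    by (auto simp: mem_appearances image_iff)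
  then show ?thesis
    by (simp add: card_image card_SigmaI finite_directions finite_starts)
qed

locale discrete_torus =
  fixes d :: nat and n :: "nat \<Rightarrow> nat"
  assumes shape_pos: "j < d \<Longrightarrow> 0 < n j"
begin

abbreviation translate_torus :: "(nat \<Rightarrow> int) \<Rightarrow> (nat \<Rightarrow> int) \<Rightarrow> nat \<Rightarrow> int" (infixl "\<oplus>" 65) where
  "p \<oplus> u \<equiv> translate d n p u"

lemma card_torus_pos: "0 < card (torus d n)"
  by (simp add: card_torus prod_pos shape_pos)

lemma translate_cong: "(\<And>j. j < d \<Longrightarrow> u j = v j) \<Longrightarrow> p \<oplus> u = p \<oplus> v"
  by (auto simp: translate_def)

lemma translate_translate: "p \<oplus> u \<oplus> v = p \<oplus> (\<lambda>j. u j + v j)"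
  by (auto simp: translate_def mod_simps add.assoc)

lemma translate_in_torus: "p \<oplus> u \<in> torus d n"
  by (auto simp: translate_def torus_def shape_pos)

lemma translate_zero:
  assumes "p \<in> torus d n" and "\<And>j. j < d \<Longrightarrow> u j = 0"
  shows "p \<oplus> u = p"
  using assms by (auto simp: translate_def torus_def PiE_iff extensional_def fun_eq_iff)

lemma translate_uminus: "p \<in> torus d n \<Longrightarrow> p \<oplus> u \<oplus> (\<lambda>j. - u j) = p"
  by (simp add: translate_translate translate_zero)

lemma bij_betw_translate: "bij_betw (\<lambda>p. p \<oplus> u) (torus d n) (torus d n)"
  by (rule bij_betwI[where g = "\<lambda>p. p \<oplus> (\<lambda>j. - u j)"])
     (auto simp: translate_in_torus translate_translate translate_zero)

lemma sum_translate: "(\<Sum>p\<in>torus d n. f (p \<oplus> u)) = (\<Sum>p\<in>torus d n. f p)"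
  by (rule sum.reindex_bij_betw[OF bij_betw_translate])

lemma walk_eq_translate: "walk d n p v i = p \<oplus> (\<lambda>j. int i * v j)"
  by (simp add: walk_def translate_def)

lemma walk_in_torus: "walk d n p v i \<in> torus d n"
  by (simp add: walk_eq_translate translate_in_torus)

lemma walk_0: "p \<in> torus d n \<Longrightarrow> walk d n p v 0 = p"
  by (simp add: walk_eq_translate translate_zero)

lemma walk_Suc: "walk d n p v (Suc i) = walk d n p v i \<oplus> v"
  by (simp add: walk_eq_translate translate_translate algebra_simps)

lemma walk_walk: "walk d n (walk d n p v i) v j = walk d n p v (i + j)"
  by (simp add: walk_eq_translate translate_translate algebra_simps)

lemma walk_cancel_right:
  "p \<in> torus d n \<Longrightarrow> q \<in> torus d n \<Longrightarrow> walk d n p v i = walk d n q v i \<Longrightarrow> p = q"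
  unfolding walk_eq_translate by (metis translate_uminus)

lemma walk_opposite:
  "j \<le> i \<Longrightarrow> walk d n (walk d n p v i) (opposite d v) j = walk d n p v (i - j)"
  unfolding walk_eq_translate translate_translate
  by (rule translate_cong) (simp add: opposite_apply of_nat_diff algebra_simps)

lemma translate_opposite: "p \<in> torus d n \<Longrightarrow> p \<oplus> v \<oplus> opposite d v = p"
  by (simp add: translate_translate translate_zero opposite_apply)

lemma card_starts_rev_le:
  "card (starts d n \<Gamma> w v) \<le> card (starts d n \<Gamma> (rev w) (opposite d v))"
proof (rule card_inj_on_le[OF _ _ finite_starts])
  let ?f = "\<lambda>p. walk d n p v (length w - 1)"
  show "inj_on ?f (starts d n \<Gamma> w v)"
    by (auto simp: inj_on_def starts_def dest: walk_cancel_right)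
  show "?f ` starts d n \<Gamma> w v \<subseteq> starts d n \<Gamma> (rev w) (opposite d v)"
  proof (rule image_subsetI)
    fix p assume "p \<in> starts d n \<Gamma> w v"
    then have spells_w: "spells (\<lambda>i. \<Gamma> (walk d n p v i)) w" by (simp add: starts_def)
    have "spells (\<lambda>i. \<Gamma> (walk d n (?f p) (opposite d v) i)) (rev w)"
      by (rule spells_revI[OF spells_w]) (simp add: walk_opposite)
    then show "?f p \<in> starts d n \<Gamma> (rev w) (opposite d v)"
      by (simp add: starts_def walk_in_torus)
  qed
qed

lemma card_starts_rev:
  assumes "v \<in> directions d"
  shows "card (starts d n \<Gamma> (rev w) v) = card (starts d n \<Gamma> w (opposite d v))"
  using card_starts_rev_le[of \<Gamma> "rev w" v] card_starts_rev_le[of \<Gamma> w "opposite d v"]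
  by (simp add: opposite_opposite[OF assms])

lemma card_appearances_rev: "card (appearances d n \<Gamma> (rev w)) = card (appearances d n \<Gamma> w)"
proof -
  have "card (appearances d n \<Gamma> (rev w)) =
      (\<Sum>v\<in>directions d. card (starts d n \<Gamma> w (opposite d v)))"
    by (simp add: card_appearances card_starts_rev)
  also have "\<dots> = (\<Sum>v\<in>directions d. card (starts d n \<Gamma> w v))"
    by (rule sum.reindex_bij_betw[OF bij_betw_opposite])
  finally show ?thesis by (simp add: card_appearances)
qed

lemma has_period_if_walks_meet:
  assumes "p \<in> starts d n \<Gamma> w v" "q \<in> starts d n \<Gamma> w v"
    and meet: "walk d n p v s = walk d n q v (s + \<delta>)"
  shows "has_period w \<delta>"
proof -
  have "p \<in> torus d n" using assms(1) by (simp add: starts_def)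
  moreover have "walk d n p v s = walk d n (walk d n q v \<delta>) v s"
    by (simp add: meet walk_walk add.commute)
  ultimately have "p = walk d n q v \<delta>" using walk_in_torus walk_cancel_right by blast
  then have "walk d n p v i = walk d n q v (i + \<delta>)" for i
    by (simp add: walk_walk add.commute)
  then show ?thesis using assms(1,2) by (auto simp: starts_def intro: has_periodI_spells)
qed

lemma inj_on_walk_appearances:
  assumes no_period: "\<And>\<delta>. 0 < \<delta> \<Longrightarrow> \<delta> < k \<Longrightarrow> \<not> has_period w \<delta>"
  shows "inj_on (\<lambda>((p, v), s). (walk d n p v s, v)) (appearances d n \<Gamma> w \<times> {..<k})"
proof -
  have step_le: "t \<le> s" if "p \<in> starts d n \<Gamma> w v" "q \<in> starts d n \<Gamma> w v" "t < k"
      and meet: "walk d n p v s = walk d n q v t" for p q v s t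
  proof (rule ccontr)
    assume "\<not> t \<le> s"
    then have "t = s + (t - s)" "0 < t - s" "t - s < k" using \<open>t < k\<close> by auto
    then show False using has_period_if_walks_meet[OF that(1,2)] meet no_period by metis
  qed
  have "p = q \<and> s = t" if "p \<in> starts d n \<Gamma> w v" "q \<in> starts d n \<Gamma> w v" "s < k" "t < k"
      and meet: "walk d n p v s = walk d n q v t" for p q v s t
  proof -
    have "s = t" using step_le that by (metis le_antisym)
    moreover have "p \<in> torus d n" "q \<in> torus d n" using that by (simp_all add: starts_def)
    ultimately show ?thesis using meet walk_cancel_right by blast
  qed
  then show ?thesis by (auto simp: inj_on_def mem_appearances)
qed

end

section \<open>Concentrations\<close>

lemma (in discrete_torus) appearances_le_concentration:
  "real (card (appearances d n \<Gamma> w)) \<le> concentration d w * real (card (torus d n))"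
proof -
  have "grid_concentration d n \<Gamma> w \<le> concentration d w"
    unfolding concentration_def
    by (rule cSup_upper[OF _ grid_concentrations_bdd_above])
       (use shape_pos in \<open>auto simp: grid_concentrations_def\<close>)
  then show ?thesis
    using card_torus_pos by (simp add: grid_concentration_def divide_le_eq)
qed

lemma concentration_leI:
  assumes "\<And>n \<Gamma>. discrete_torus d n \<Longrightarrow>
    real (card (appearances d n \<Gamma> w)) \<le> c * real (card (torus d n))"
  shows "concentration d w \<le> c"
  unfolding concentration_def
proof (rule cSup_least[OF grid_concentrations_nonempty])
  fix x assume "x \<in> grid_concentrations d w"
  then obtain n \<Gamma> where x_eq: "x = grid_concentration d n \<Gamma> w" and torus: "discrete_torus d n"
    by (auto simp: grid_concentrations_def discrete_torus_def)
  show "x \<le> c"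
    using assms[OF torus, of \<Gamma>] discrete_torus.card_torus_pos[OF torus]
    by (simp add: x_eq grid_concentration_def divide_le_eq)
qed

lemma concentration_geI:
  assumes "discrete_torus d n" "c * real (card (torus d n)) \<le> real (card (appearances d n \<Gamma> w))"
  shows "c \<le> concentration d w"
proof -
  interpret discrete_torus d n by fact
  show ?thesis
    using appearances_le_concentration[of \<Gamma> w] assms(2) card_torus_pos
    by (meson mult_right_le_imp_le of_nat_0_less_iff order_trans)
qed

lemma concentration_nonneg: "0 \<le> concentration d w"
  by (rule concentration_geI[of d "\<lambda>_. 1"]) (simp_all add: discrete_torus_def)

lemma concentration_rev_le: "concentration d (rev w) \<le> concentration d w"
  by (rule concentration_leI)
     (simp add: discrete_torus.card_appearances_rev discrete_torus.appearances_le_concentration)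

lemma concentration_rev: "concentration d (rev w) = concentration d w"
  using concentration_rev_le[of d w] concentration_rev_le[of d "rev w"] by simp

lemma stackable_rev: "stackable d (rev w) \<longleftrightarrow> stackable d w"
  by (simp add: stackable_def concentration_rev)

lemma concentration_append_le: "concentration d (u @ w) \<le> concentration d u"
proof (rule concentration_leI)
  fix n and \<Gamma> :: "(nat \<Rightarrow> int) \<Rightarrow> 'a" assume "discrete_torus d n"
  then interpret discrete_torus d n .
  have "appearances d n \<Gamma> (u @ w) \<subseteq> appearances d n \<Gamma> u"
    by (auto simp: mem_appearances starts_def dest: spells_appendD)
  then have "card (appearances d n \<Gamma> (u @ w)) \<le> card (appearances d n \<Gamma> u)"
    by (intro card_mono finite_appearances)
  then show "real (card (appearances d n \<Gamma> (u @ w))) \<le> concentration d u * real (card (torus d n))"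
    using appearances_le_concentration[of \<Gamma> u] by linarith
qed

text \<open>Identifying letters so that a word becomes a palindrome lets both of its orientations be
  counted as appearances of the image.\<close>

lemma concentration_map_palindrome:
  fixes h :: "'a \<Rightarrow> 'b"
  assumes palindrome: "map h (rev w) = map h w" and "rev w \<noteq> w"
  shows "2 * concentration d w \<le> concentration d (map h w)"
proof -
  have "concentration d w \<le> concentration d (map h w) / 2"
  proof (rule concentration_leI)
    fix n and \<Gamma> :: "(nat \<Rightarrow> int) \<Rightarrow> 'a" assume "discrete_torus d n"
    then interpret discrete_torus d n .
    have "(p, v) \<notin> appearances d n \<Gamma> (rev w)" if "(p, v) \<in> appearances d n \<Gamma> w" for p v
      using that assms(2) by (auto simp: mem_appearances starts_def dest: spells_eq_length_imp_eq)
    then have disjoint: "appearances d n \<Gamma> w \<inter> appearances d n \<Gamma> (rev w) = {}" by auto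
    have image: "appearances d n \<Gamma> u \<subseteq> appearances d n (\<lambda>p. h (\<Gamma> p)) (map h u)" for u
      by (auto simp: mem_appearances starts_def intro: spells_map)
    have "2 * card (appearances d n \<Gamma> w) = card (appearances d n \<Gamma> w \<union> appearances d n \<Gamma> (rev w))"
      by (simp add: card_Un_disjoint[OF finite_appearances finite_appearances disjoint]
          card_appearances_rev)
    also have "\<dots> \<le> card (appearances d n (\<lambda>p. h (\<Gamma> p)) (map h w))"
      using image[of w] image[of "rev w"] palindrome by (intro card_mono finite_appearances) auto
    finally show "real (card (appearances d n \<Gamma> w)) \<le>
        concentration d (map h w) / 2 * real (card (torus d n))"
      using appearances_le_concentration[of "\<lambda>p. h (\<Gamma> p)" "map h w"] by linarith
  qed
  then show ?thesis by simp
qed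

lemma concentration_le_if_no_period:
  assumes "0 < k" and no_period: "\<And>\<delta>. 0 < \<delta> \<Longrightarrow> \<delta> < k \<Longrightarrow> \<not> has_period w \<delta>"
  shows "concentration d w \<le> real (card (directions d)) / real k"
proof (rule concentration_leI)
  fix n and \<Gamma> :: "(nat \<Rightarrow> int) \<Rightarrow> 'a" assume "discrete_torus d n"
  then interpret discrete_torus d n .
  have "card (appearances d n \<Gamma> w) * k = card (appearances d n \<Gamma> w \<times> {..<k})"
    by (simp add: card_cartesian_product)
  also have "\<dots> \<le> card (torus d n \<times> directions d)"
    by (rule card_inj_on_le[OF inj_on_walk_appearances[OF no_period]])
       (auto simp: mem_appearances walk_in_torus finite_torus finite_directions)
  finally have "real (card (appearances d n \<Gamma> w)) * real k
      \<le> real (card (torus d n)) * real (card (directions d))"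
    by (simp add: card_cartesian_product flip: of_nat_mult)
  then show "real (card (appearances d n \<Gamma> w))
      \<le> real (card (directions d)) / real k * real (card (torus d n))"
    using \<open>0 < k\<close> by (simp add: field_simps)
qed

section \<open>One-dimensional grids\<close>

definition cyclic_hits :: "nat \<Rightarrow> (nat \<Rightarrow> 'a) \<Rightarrow> 'a list \<Rightarrow> nat set" where
  "cyclic_hits m h w = {x \<in> {..<m}. spells (\<lambda>i. h ((x + i) mod m)) w}"

lemma finite_cyclic_hits: "finite (cyclic_hits m h w)"
  by (simp add: cyclic_hits_def)

lemma directions_first_eq_PiE:
  assumes "0 < d" "s \<in> {-1, 1}"
  shows "{v \<in> directions d. v 0 = s} = (\<Pi>\<^sub>E i\<in>{..<d}. if i = 0 then {s} else {-1, 0, 1})"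
proof -
  have "v \<noteq> (\<lambda>i\<in>{..<d}. 0)" if "v 0 = s" for v
    using that assms by auto
  then show ?thesis
    using assms by (fastforce simp: directions_def PiE_iff extensional_def split: if_splits)
qed

lemma card_directions_first_coordinate:
  assumes "0 < d" "s \<in> {-1, 1}"
  shows "card {v \<in> directions d. v 0 = s} = 3 ^ (d - 1)"
proof -
  obtain e where d_eq: "d = Suc e" using assms(1) gr0_implies_Suc by blast
  have "card {v \<in> directions d. v 0 = s} = (\<Prod>i<d. if i = 0 then 1 else 3)"
    unfolding directions_first_eq_PiE[OF assms] card_PiE[OF finite_lessThan]
    by (rule prod.cong) simp_all
  then show ?thesis
    by (simp add: d_eq prod.lessThan_Suc_shift del: prod.lessThan_Suc)
qed

context discrete_torus
begin

lemma starts_eq_cyclic_hits: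
  assumes "0 < d" "v 0 = 1"
  shows "starts d n (\<lambda>p. h (nat (p 0))) w v = {p \<in> torus d n. nat (p 0) \<in> cyclic_hits (n 0) h w}"
proof -
  have "nat (walk d n p v i 0) = (nat (p 0) + i) mod n 0" and "nat (p 0) < n 0"
    if "p \<in> torus d n" for p i
  proof -
    have p_0_bounds: "0 \<le> p 0" "p 0 < int (n 0)" using torus_coordinate[OF that assms(1)] by auto
    then show "nat (p 0) < n 0" by auto
    have "walk d n p v i 0 = int ((nat (p 0) + i) mod n 0)"
      using p_0_bounds assms by (simp add: walk_def zmod_int)
    then show "nat (walk d n p v i 0) = (nat (p 0) + i) mod n 0" by simp
  qed
  then show ?thesis by (auto simp: starts_def cyclic_hits_def)
qed

lemma bij_betw_flat_torus:
  assumes "0 < d" and flat: "\<And>j. 0 < j \<Longrightarrow> j < d \<Longrightarrow> n j = 1"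
  shows "bij_betw (\<lambda>p. nat (p 0)) (torus d n) {..<n 0}"
proof (rule bij_betwI[where g = "\<lambda>x. \<lambda>j\<in>{..<d}. if j = 0 then int x else 0"])
  have "0 < n j" if "j < d" for j using shape_pos that .
  then show "(\<lambda>x. \<lambda>j\<in>{..<d}. if j = 0 then int x else 0) \<in> {..<n 0} \<rightarrow> torus d n"
    by (auto simp: torus_def)
  show "(\<lambda>p. nat (p 0)) \<in> torus d n \<rightarrow> {..<n 0}"
    using torus_coordinate[of _ d n 0] assms(1) by (fastforce simp: nat_less_iff)
  fix p assume p_in_torus: "p \<in> torus d n"
  show "(\<lambda>j\<in>{..<d}. if j = 0 then int (nat (p 0)) else 0) = p"
  proof
    fix j
    have "p j = 0" if "0 < j" "j < d"
      using torus_coordinate[OF p_in_torus that(2)] flat[OF that] by simp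
    then show "(\<lambda>j\<in>{..<d}. if j = 0 then int (nat (p 0)) else 0) j = p j"
      using p_in_torus torus_coordinate[OF p_in_torus assms(1)]
      by (cases "j < d") (auto simp: torus_def PiE_iff extensional_def)
  qed
qed (use assms in auto)

lemma card_starts_eq_card_cyclic_hits:
  assumes "0 < d" "\<And>j. 0 < j \<Longrightarrow> j < d \<Longrightarrow> n j = 1" "v 0 = 1"
  shows "card (starts d n (\<lambda>p. h (nat (p 0))) w v) = card (cyclic_hits (n 0) h w)"
proof -
  have bijection: "bij_betw (\<lambda>p. nat (p 0)) (torus d n) {..<n 0}"
    by (rule bij_betw_flat_torus) fact+
  have "(\<lambda>p. nat (p 0)) ` starts d n (\<lambda>p. h (nat (p 0))) w v = cyclic_hits (n 0) h w"
    using bij_betw_imp_surj_on[OF bijection] starts_eq_cyclic_hits[of v h w] assms(1,3)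
    by (auto simp: cyclic_hits_def image_iff)
  moreover have "inj_on (\<lambda>p. nat (p 0)) (starts d n (\<lambda>p. h (nat (p 0))) w v)"
    using bij_betw_imp_inj_on[OF bijection] by (rule inj_on_subset) (auto simp: starts_def)
  ultimately show ?thesis by (metis card_image)
qed

lemma card_starts_eq_card_cyclic_hits_rev:
  assumes "0 < d" "\<And>j. 0 < j \<Longrightarrow> j < d \<Longrightarrow> n j = 1" "v \<in> directions d" "v 0 = -1"
  shows "card (starts d n (\<lambda>p. h (nat (p 0))) w v) = card (cyclic_hits (n 0) h (rev w))"
  using assms card_starts_rev[OF assms(3), of "\<lambda>p. h (nat (p 0))" "rev w"]
  by (simp add: card_starts_eq_card_cyclic_hits opposite_apply)

lemma card_appearances_ge_cyclic_hits:
  assumes "0 < d" "\<And>j. 0 < j \<Longrightarrow> j < d \<Longrightarrow> n j = 1"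
  shows "3 ^ (d - 1) * (card (cyclic_hits (n 0) h w) + card (cyclic_hits (n 0) h (rev w)))
    \<le> card (appearances d n (\<lambda>p. h (nat (p 0))) w)"
proof -
  let ?D = "\<lambda>s. {v \<in> directions d. v 0 = s}"
  let ?S = "\<lambda>v. card (starts d n (\<lambda>p. h (nat (p 0))) w v)"
  have "3 ^ (d - 1) * (card (cyclic_hits (n 0) h w) + card (cyclic_hits (n 0) h (rev w)))
      = (\<Sum>v\<in>?D 1. ?S v) + (\<Sum>v\<in>?D (-1). ?S v)"
    using assms
    by (simp add: card_starts_eq_card_cyclic_hits card_starts_eq_card_cyclic_hits_rev
        card_directions_first_coordinate distrib_left)
  also have "\<dots> = (\<Sum>v\<in>?D 1 \<union> ?D (-1). ?S v)"
    by (rule sum.union_disjoint[symmetric]) (auto simp: finite_directions)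
  also have "\<dots> \<le> (\<Sum>v\<in>directions d. ?S v)"
    by (rule sum_mono2) (auto simp: finite_directions)
  finally show ?thesis by (simp add: card_appearances)
qed

end

lemma directions_1: "directions 1 = {\<lambda>j\<in>{..<1}. 1, \<lambda>j\<in>{..<1}. -1}"
proof -
  have "v \<in> {\<lambda>j\<in>{..<1}. 1, \<lambda>j\<in>{..<1}. -1}" if "v \<in> directions 1" for v
  proof -
    have "v = (\<lambda>j\<in>{..<1}. v 0)" "v 0 \<in> {-1, 0, 1}" "v \<noteq> (\<lambda>j\<in>{..<1}. 0)"
      using that by (auto simp: directions_def PiE_iff extensional_def fun_eq_iff)
    then show ?thesis by (metis insertE insertI1 insertI2 singletonD)
  qed
  moreover have "(\<lambda>j\<in>{..<1}. s) \<in> directions 1" if "s \<noteq> 0" "s \<in> {-1, 0, 1}" for s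
    using that by (auto simp: directions_def dest: fun_cong[of _ _ 0])
  ultimately show ?thesis by auto
qed

lemma card_directions_1: "card (directions 1) = 2"
  by (simp add: directions_1 fun_eq_iff del: One_nat_def)

lemma card_appearances_1:
  fixes \<Gamma> :: "(nat \<Rightarrow> int) \<Rightarrow> 'a"
  assumes "discrete_torus 1 n"
  defines "h \<equiv> \<lambda>x. \<Gamma> (\<lambda>j\<in>{..<1}. int x)"
  shows "card (appearances 1 n \<Gamma> w)
    = card (cyclic_hits (n 0) h w) + card (cyclic_hits (n 0) h (rev w))"
proof -
  interpret discrete_torus 1 n by fact
  let ?D = "\<lambda>s :: int. \<lambda>j\<in>{..<1 :: nat}. s"
  have "\<Gamma> p = h (nat (p 0))" if "p \<in> torus 1 n" for p
    using that unfolding h_def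
    by (intro arg_cong[where f = \<Gamma>]) (auto simp: torus_def PiE_iff extensional_def fun_eq_iff)
  then have starts: "starts 1 n \<Gamma> w v = starts 1 n (\<lambda>p. h (nat (p 0))) w v" for v
    by (simp add: starts_def walk_in_torus del: One_nat_def)
  have "?D 1 \<in> directions 1" "?D (-1) \<in> directions 1" "?D 1 \<noteq> ?D (-1)"
    by (simp_all add: directions_1 fun_eq_iff del: One_nat_def)
  then have "card (appearances 1 n \<Gamma> w) =
      card (starts 1 n \<Gamma> w (?D 1)) + card (starts 1 n \<Gamma> w (?D (-1)))"
    unfolding card_appearances directions_1 by simp
  then show ?thesis
    using \<open>?D (-1) \<in> directions 1\<close>
    by (simp add: starts card_starts_eq_card_cyclic_hits card_starts_eq_card_cyclic_hits_rev
        del: One_nat_def)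
qed

lemma cyclic_hits_le_concentration:
  assumes "0 < d" "0 < m"
  shows "3 ^ (d - 1) * real (card (cyclic_hits m h w) + card (cyclic_hits m h (rev w)))
    \<le> concentration d w * real m"
proof -
  let ?n = "\<lambda>j :: nat. if j = 0 then m else 1"
  interpret discrete_torus d ?n
    by unfold_locales (use assms in simp)
  have "card (torus d ?n) = m"
    using bij_betw_same_card[OF bij_betw_flat_torus[OF assms(1)]] by simp
  moreover have "3 ^ (d - 1) * (card (cyclic_hits m h w) + card (cyclic_hits m h (rev w)))
      \<le> card (appearances d ?n (\<lambda>p. h (nat (p 0))) w)"
    using card_appearances_ge_cyclic_hits[of h w] assms(1) by simp
  then have "real (3 ^ (d - 1) * (card (cyclic_hits m h w) + card (cyclic_hits m h (rev w))))
      \<le> real (card (appearances d ?n (\<lambda>p. h (nat (p 0))) w))"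
    by (simp only: of_nat_le_iff)
  ultimately show ?thesis
    using appearances_le_concentration[of "\<lambda>p. h (nat (p 0))" w] by simp
qed

lemma concentration_1_leI:
  assumes "\<And>m h. 0 < m \<Longrightarrow>
    real (card (cyclic_hits m h w) + card (cyclic_hits m h (rev w))) \<le> c * real m"
  shows "concentration 1 w \<le> c"
proof (rule concentration_leI)
  fix n and \<Gamma> :: "(nat \<Rightarrow> int) \<Rightarrow> 'a" assume torus: "discrete_torus 1 n"
  then have "0 < n 0" by (simp add: discrete_torus_def)
  then show "real (card (appearances 1 n \<Gamma> w)) \<le> c * real (card (torus 1 n))"
    using assms by (simp add: card_torus card_appearances_1[OF torus, unfolded One_nat_def])
qed

lemma concentration_ge_stack:
  assumes "0 < d"
  shows "3 ^ (d - 1) * concentration 1 w \<le> concentration d w"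
proof -
  have "concentration 1 w \<le> concentration d w / 3 ^ (d - 1)"
    by (rule concentration_1_leI)
       (use cyclic_hits_le_concentration[OF assms, of _ _ w] in \<open>simp add: field_simps\<close>)
  then show ?thesis by (simp add: field_simps)
qed

lemma stackable_iff_le:
  "0 < d \<Longrightarrow> stackable d w \<longleftrightarrow> concentration d w \<le> 3 ^ (d - 1) * concentration 1 w"
  unfolding stackable_def using concentration_ge_stack[of d w] by linarith

section \<open>Words read along the orbits of a permutation\<close>

definition orbit_starts :: "'b set \<Rightarrow> ('b \<Rightarrow> 'b) \<Rightarrow> ('b \<Rightarrow> 'a) \<Rightarrow> 'a list \<Rightarrow> 'b set" where
  "orbit_starts E T L w = {e \<in> E. spells (\<lambda>i. L ((T ^^ i) e)) w}"

lemma sum_card_orbit_visits: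
  assumes "finite E" "T permutes E" "A \<subseteq> E"
  shows "(\<Sum>e\<in>E. card {x \<in> {..<N}. (T ^^ x) e \<in> A}) = N * card A"
proof -
  have visit: "card {e \<in> E. (T ^^ x) e \<in> A} = card A" for x
  proof -
    have "bij_betw (T ^^ x) E E"
      using permutes_funpow[OF assms(2)] by (rule permutes_imp_bij)
    then have "(\<Sum>e\<in>E. of_bool ((T ^^ x) e \<in> A)) = (\<Sum>e\<in>E. of_bool (e \<in> A) :: nat)"
      by (rule sum.reindex_bij_betw)
    moreover have "E \<inter> {e. e \<in> A} = A" using assms(3) by auto
    ultimately show ?thesis using assms(1) by (simp add: Int_def)
  qed
  have "(\<Sum>e\<in>E. card {x \<in> {..<N}. (T ^^ x) e \<in> A}) = (\<Sum>e\<in>E. \<Sum>x<N. of_bool ((T ^^ x) e \<in> A))"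
    by (simp add: Int_def)
  also have "\<dots> = (\<Sum>x<N. \<Sum>e\<in>E. of_bool ((T ^^ x) e \<in> A))"
    by (rule sum.swap)
  also have "\<dots> = (\<Sum>x<N. card {e \<in> E. (T ^^ x) e \<in> A})"
    by (simp add: assms(1) Int_def)
  finally show ?thesis by (simp add: visit)
qed

text \<open>Every orbit is a one-dimensional grid; a common period of all orbits avoids decomposing
  \<open>E\<close> into orbits.\<close>

lemma orbit_starts_le_concentration:
  assumes "finite E" "T permutes E"
  shows "real (card (orbit_starts E T L w) + card (orbit_starts E T L (rev w)))
    \<le> concentration 1 w * real (card E)"
proof -
  obtain N where period: "T ^^ N = id" "0 < N"
    using permutation_is_nilpotent assms permutation_permutes by blast
  define h where "h e x = L ((T ^^ x) e)" for e x
  have hits_eq: "cyclic_hits N (h e) u = {x \<in> {..<N}. (T ^^ x) e \<in> orbit_starts E T L u}"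
    if "e \<in> E" for e u
  proof -
    have "(T ^^ x) e \<in> E" for x
      using that permutes_in_image[OF permutes_funpow[OF assms(2)]] by blast
    moreover have "h e ((x + i) mod N) = L ((T ^^ i) ((T ^^ x) e))" for x i
      using funpow_mod_eq[of N T e "i + x"] period(1) by (simp add: h_def add.commute funpow_add)
    ultimately show ?thesis by (simp add: cyclic_hits_def orbit_starts_def)
  qed
  have sum_hits: "(\<Sum>e\<in>E. card (cyclic_hits N (h e) u)) = N * card (orbit_starts E T L u)" for u
    using sum_card_orbit_visits[OF assms, of "orbit_starts E T L u" N]
    by (simp add: hits_eq) (simp add: orbit_starts_def)
  have "real N * real (card (orbit_starts E T L w) + card (orbit_starts E T L (rev w)))
      = (\<Sum>e\<in>E. real (card (cyclic_hits N (h e) w) + card (cyclic_hits N (h e) (rev w))))"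
    by (simp add: sum.distrib sum_hits distrib_left flip: of_nat_sum)
  also have "\<dots> \<le> (\<Sum>e\<in>E. concentration 1 w * real N)"
    using period(2) cyclic_hits_le_concentration[of 1 N _ w] by (intro sum_mono) simp
  also have "\<dots> = real N * (concentration 1 w * real (card E))" by simp
  finally show ?thesis using period(2) by simp
qed

lemma orbit_starts_reversible_le_concentration:
  assumes "finite E" "T permutes E" "R permutes E"
    and reversal: "\<And>e. T (R (T e)) = R e" and labels: "\<And>e. L (R e) = L e"
  shows "2 * real (card (orbit_starts E T L w)) \<le> concentration 1 w * real (card E)"
proof -
  have reverse: "(T ^^ i) (R ((T ^^ j) e)) = R ((T ^^ (j - i)) e)" if "i \<le> j" for i j e
    using that
  proof (induction i)
    case (Suc i)
    then have "(T ^^ (j - i)) e = T ((T ^^ (j - Suc i)) e)"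
      by (metis Suc_diff_Suc Suc_le_lessD comp_apply funpow.simps(2))
    then show ?case using Suc by (simp add: reversal)
  qed simp
  let ?f = "\<lambda>e. R ((T ^^ (length w - 1)) e)"
  have f_permutes: "?f permutes E"
    using permutes_compose[OF permutes_funpow[OF assms(2)] assms(3)] by (simp add: o_def)
  have "card (orbit_starts E T L w) \<le> card (orbit_starts E T L (rev w))"
  proof (rule card_inj_on_le)
    show "inj_on ?f (orbit_starts E T L w)"
      using permutes_inj_on[OF f_permutes] .
    show "?f ` orbit_starts E T L w \<subseteq> orbit_starts E T L (rev w)"
    proof (rule image_subsetI)
      fix e assume "e \<in> orbit_starts E T L w"
      then have "e \<in> E" and spells_w: "spells (\<lambda>i. L ((T ^^ i) e)) w"
        by (simp_all add: orbit_starts_def)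
      have "spells (\<lambda>i. L ((T ^^ i) (?f e))) (rev w)"
        by (rule spells_revI[OF spells_w]) (simp add: reverse labels)
      then show "?f e \<in> orbit_starts E T L (rev w)"
        using permutes_in_image[OF f_permutes] \<open>e \<in> E\<close> by (simp add: orbit_starts_def)
    qed
  qed (simp add: orbit_starts_def assms(1))
  then show ?thesis using orbit_starts_le_concentration[OF assms(1,2), of L w] by simp
qed

section \<open>Words read along a symmetric set of edges\<close>

lemma involution_permutes:
  assumes "\<And>x. x \<notin> E \<Longrightarrow> f x = x" "\<And>x. f (f x) = x"
  shows "f permutes E"
  unfolding permutes_def using assms by metis

locale symmetric_edges = discrete_torus +
  fixes E :: "((nat \<Rightarrow> int) \<times> (nat \<Rightarrow> int)) set"
  assumes edges_subset: "E \<subseteq> torus d n \<times> directions d"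
    and opposite_edge: "(p, v) \<in> E \<Longrightarrow> (p \<oplus> v, opposite d v) \<in> E"
begin

definition cross :: "(nat \<Rightarrow> int) \<times> (nat \<Rightarrow> int) \<Rightarrow> (nat \<Rightarrow> int) \<times> (nat \<Rightarrow> int)" where
  "cross = (\<lambda>(p, v). if (p, v) \<in> E then (p \<oplus> v, opposite d v) else (p, v))"

definition turn :: "(nat \<Rightarrow> int) \<times> (nat \<Rightarrow> int) \<Rightarrow> (nat \<Rightarrow> int) \<times> (nat \<Rightarrow> int)" where
  "turn = (\<lambda>(p, v). if (p, v) \<in> E \<and> (p, opposite d v) \<in> E then (p, opposite d v) else (p, v))"

text \<open>Where the next edge of a line is missing, \<open>advance\<close> turns back, so that it permutes the edges
  and its orbits are closed walks.\<close>

definition advance :: "(nat \<Rightarrow> int) \<times> (nat \<Rightarrow> int) \<Rightarrow> (nat \<Rightarrow> int) \<times> (nat \<Rightarrow> int)" where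
  "advance = turn \<circ> cross"

lemma finite_edges: "finite E"
  by (rule finite_subset[OF edges_subset]) (simp add: finite_torus finite_directions)

lemma edgeD: "(p, v) \<in> E \<Longrightarrow> p \<in> torus d n \<and> v \<in> directions d"
  using edges_subset by auto

lemma opposite_opposite_edge: "(p, v) \<in> E \<Longrightarrow> opposite d (opposite d v) = v"
  using edgeD opposite_opposite by blast

lemma cross_cross: "cross (cross e) = e"
  by (cases e) (auto simp: cross_def opposite_edge opposite_opposite_edge translate_opposite
      dest: edgeD)

lemma turn_turn: "turn (turn e) = e"
  by (cases e) (auto simp: turn_def opposite_opposite_edge)

lemma turn_permutes: "turn permutes E"
  by (rule involution_permutes[OF _ turn_turn]) (auto simp: turn_def)

lemma advance_permutes: "advance permutes E"
proof -
  have "cross permutes E"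
    by (rule involution_permutes[OF _ cross_cross]) (auto simp: cross_def)
  then show ?thesis unfolding advance_def using turn_permutes by (rule permutes_compose)
qed

lemma advance_turn_advance: "advance (turn (advance e)) = turn e"
  by (simp add: advance_def turn_turn cross_cross)

lemma fst_turn: "fst (turn e) = fst e"
  by (simp add: turn_def split: prod.split)

lemma fst_advance: "(p, v) \<in> E \<Longrightarrow> fst (advance (p, v)) = p \<oplus> v"
  by (simp add: advance_def fst_turn cross_def)

lemma advance_straight:
  assumes "(p, v) \<in> E" "(p \<oplus> v, v) \<in> E"
  shows "advance (p, v) = (p \<oplus> v, v)"
  using assms opposite_edge[OF assms(1)] opposite_opposite_edge[OF assms(1)]
  by (simp add: advance_def cross_def turn_def)

lemma advance_funpow_straight:
  assumes "p \<in> torus d n" "\<And>j. j \<le> i \<Longrightarrow> (walk d n p v j, v) \<in> E"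
  shows "(advance ^^ i) (p, v) = (walk d n p v i, v)"
  using assms(2)
proof (induction i)
  case 0
  then show ?case by (simp add: walk_0 assms(1))
next
  case (Suc i)
  have "(advance ^^ Suc i) (p, v) = advance (walk d n p v i, v)" using Suc by simp
  also have "\<dots> = (walk d n p v (Suc i), v)"
    using Suc.prems[of i] Suc.prems[of "Suc i"] by (simp add: walk_Suc advance_straight)
  finally show ?case .
qed

lemma fst_advance_funpow:
  assumes "p \<in> torus d n" "\<And>j. j < i \<Longrightarrow> (walk d n p v j, v) \<in> E"
  shows "fst ((advance ^^ i) (p, v)) = walk d n p v i"
proof (cases i)
  case 0
  then show ?thesis by (simp add: walk_0 assms(1))
next
  case (Suc j)
  then have "(advance ^^ j) (p, v) = (walk d n p v j, v)"
    using assms by (intro advance_funpow_straight) auto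
  then show ?thesis using assms(2)[of j] by (simp add: Suc fst_advance walk_Suc)
qed

lemma appearances_along_edges_le:
  assumes "2 \<le> length w"
    and along: "\<And>p v i. (p, v) \<in> appearances d n \<Gamma> w \<Longrightarrow> Suc i < length w \<Longrightarrow> (walk d n p v i, v) \<in> E"
  shows "2 * real (card (appearances d n \<Gamma> w)) \<le> concentration 1 w * real (card E)"
proof -
  let ?L = "\<lambda>e. \<Gamma> (fst e)"
  have "e \<in> orbit_starts E advance ?L w" if "e \<in> appearances d n \<Gamma> w" for e
  proof -
    obtain p v where e_eq: "e = (p, v)" by (cases e)
    have p_in_torus: "p \<in> torus d n" and spells_w: "spells (\<lambda>i. \<Gamma> (walk d n p v i)) w"
      using that by (auto simp: e_eq mem_appearances starts_def)
    have "fst ((advance ^^ i) (p, v)) = walk d n p v i" if "i < length w" for i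
      using \<open>e \<in> appearances d n \<Gamma> w\<close> along that
      by (intro fst_advance_funpow p_in_torus) (auto simp: e_eq)
    then have "spells (\<lambda>i. ?L ((advance ^^ i) e)) w"
      using spells_w by (simp add: spells_def e_eq)
    moreover have "e \<in> E" using along[of p v 0] that assms(1) by (simp add: e_eq walk_0 p_in_torus)
    ultimately show ?thesis by (simp add: orbit_starts_def)
  qed
  then have "card (appearances d n \<Gamma> w) \<le> card (orbit_starts E advance ?L w)"
    by (intro card_mono) (auto simp: orbit_starts_def finite_edges)
  then show ?thesis
    using orbit_starts_reversible_le_concentration[OF finite_edges advance_permutes turn_permutes
        advance_turn_advance, of ?L w]
    by (simp add: fst_turn)
qed

end

section \<open>Cuts of the king graph on the torus\<close>

abbreviation axis_step :: "int \<Rightarrow> nat \<Rightarrow> nat \<Rightarrow> int" where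
  "axis_step s k \<equiv> (\<lambda>j. if j = k then s else 0)"

context discrete_torus
begin

definition torus_inner :: "((nat \<Rightarrow> int) \<Rightarrow> real) \<Rightarrow> ((nat \<Rightarrow> int) \<Rightarrow> real) \<Rightarrow> real" where
  "torus_inner f g = (\<Sum>p\<in>torus d n. f p * g p)"

fun box_sum :: "nat \<Rightarrow> ((nat \<Rightarrow> int) \<Rightarrow> real) \<Rightarrow> (nat \<Rightarrow> int) \<Rightarrow> real" where
  "box_sum 0 f p = f p"
| "box_sum (Suc k) f p = box_sum k f p + box_sum k f (p \<oplus> axis_step 1 k)
     + box_sum k f (p \<oplus> axis_step (-1) k)"

lemma torus_inner_self_nonneg: "0 \<le> torus_inner f f"
  by (simp add: torus_inner_def sum_nonneg)

lemma torus_inner_cong: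
  "(\<And>p. p \<in> torus d n \<Longrightarrow> f p * g p = f' p * g' p) \<Longrightarrow> torus_inner f g = torus_inner f' g'"
  by (simp add: torus_inner_def)

lemma torus_inner_add_left: "torus_inner (\<lambda>p. f p + f' p) g = torus_inner f g + torus_inner f' g"
  and torus_inner_add_right: "torus_inner f (\<lambda>p. g p + g' p) = torus_inner f g + torus_inner f g'"
  and torus_inner_diff_left: "torus_inner (\<lambda>p. f p - f' p) g = torus_inner f g - torus_inner f' g"
  and torus_inner_diff_right: "torus_inner f (\<lambda>p. g p - g' p) = torus_inner f g - torus_inner f g'"
  by (simp_all add: torus_inner_def algebra_simps sum.distrib sum_subtractf)

lemmas torus_inner_linear = torus_inner_add_left torus_inner_add_right
  torus_inner_diff_left torus_inner_diff_right

lemma torus_inner_translate: "torus_inner (\<lambda>p. f (p \<oplus> u)) (\<lambda>p. g (p \<oplus> u)) = torus_inner f g"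
  unfolding torus_inner_def by (rule sum_translate)

lemma torus_inner_translate_right:
  "torus_inner f (\<lambda>p. g (p \<oplus> axis_step (-1) k)) = torus_inner (\<lambda>p. f (p \<oplus> axis_step 1 k)) g"
proof -
  have "torus_inner f (\<lambda>p. g (p \<oplus> axis_step (-1) k))
      = torus_inner (\<lambda>p. f (p \<oplus> axis_step 1 k)) (\<lambda>p. g (p \<oplus> axis_step 1 k \<oplus> axis_step (-1) k))"
    using torus_inner_translate[of f "axis_step 1 k" "\<lambda>p. g (p \<oplus> axis_step (-1) k)"] by simp
  also have "\<dots> = torus_inner (\<lambda>p. f (p \<oplus> axis_step 1 k)) g"
    by (rule torus_inner_cong) (simp add: translate_translate translate_zero)
  finally show ?thesis .
qed

lemma box_sum_translate: "box_sum k (\<lambda>p. f (p \<oplus> u)) = (\<lambda>p. box_sum k f (p \<oplus> u))"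
proof
  show "box_sum k (\<lambda>p. f (p \<oplus> u)) p = box_sum k f (p \<oplus> u)" for p
    by (induction k arbitrary: p) (simp_all add: translate_translate add.commute)
qed

lemma box_sum_add: "box_sum k (\<lambda>p. f p + g p) = (\<lambda>p. box_sum k f p + box_sum k g p)"
proof
  show "box_sum k (\<lambda>p. f p + g p) p = box_sum k f p + box_sum k g p" for p
    by (induction k arbitrary: p) simp_all
qed

lemma box_sum_diff: "box_sum k (\<lambda>p. f p - g p) = (\<lambda>p. box_sum k f p - box_sum k g p)"
proof
  show "box_sum k (\<lambda>p. f p - g p) p = box_sum k f p - box_sum k g p" for p
    by (induction k arbitrary: p) simp_all
qed

text \<open>With \<open>S\<close> the translation along axis \<open>k\<close>, this is
  \<open>4 (1 + S + S\<^sup>*) = 3 (1 + S)(1 + S\<^sup>*) - (1 - S)(1 - S\<^sup>*)\<close>.\<close>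

lemma torus_inner_box_sum_Suc:
  fixes f k
  defines "g \<equiv> \<lambda>p. f (p \<oplus> axis_step 1 k)"
  shows "4 * torus_inner f (box_sum (Suc k) f) =
      3 * torus_inner (\<lambda>p. f p + g p) (box_sum k (\<lambda>p. f p + g p))
      - torus_inner (\<lambda>p. f p - g p) (box_sum k (\<lambda>p. f p - g p))"
proof -
  have box_sum_g: "box_sum k g = (\<lambda>p. box_sum k f (p \<oplus> axis_step 1 k))"
    unfolding g_def by (rule box_sum_translate)
  have "torus_inner g (box_sum k g) = torus_inner f (box_sum k f)"
    unfolding box_sum_g unfolding g_def by (rule torus_inner_translate)
  moreover have "box_sum (Suc k) f =
      (\<lambda>p. box_sum k f p + box_sum k g p + box_sum k f (p \<oplus> axis_step (-1) k))"
    by (simp add: box_sum_g fun_eq_iff)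
  then have "torus_inner f (box_sum (Suc k) f) =
      torus_inner f (box_sum k f) + torus_inner f (box_sum k g) + torus_inner g (box_sum k f)"
    by (simp add: torus_inner_linear torus_inner_translate_right g_def)
  ultimately show ?thesis
    unfolding box_sum_add box_sum_diff by (simp add: torus_inner_linear)
qed

lemma torus_inner_parallelogram:
  "4 * torus_inner f f = torus_inner (\<lambda>p. f p + f (p \<oplus> u)) (\<lambda>p. f p + f (p \<oplus> u))
     + torus_inner (\<lambda>p. f p - f (p \<oplus> u)) (\<lambda>p. f p - f (p \<oplus> u))"
  using torus_inner_translate[of f u f] by (simp add: torus_inner_linear)

lemma torus_inner_box_sum_bounds:
  "- (3 ^ k / 3) * torus_inner f f \<le> torus_inner f (box_sum k f)
    \<and> torus_inner f (box_sum k f) \<le> 3 ^ k * torus_inner f f"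
proof (induction k arbitrary: f)
  case 0
  then show ?case
    using torus_inner_self_nonneg[of f] by simp
next
  case (Suc k)
  let ?P = "\<lambda>p. f p + f (p \<oplus> axis_step 1 k)" and ?M = "\<lambda>p. f p - f (p \<oplus> axis_step 1 k)"
  have "0 \<le> 3 ^ k * torus_inner ?M ?M" using torus_inner_self_nonneg by simp
  moreover have "3 ^ Suc k * (4 * torus_inner f f)
      = 3 * (3 ^ k * torus_inner ?P ?P) + 3 * (3 ^ k * torus_inner ?M ?M)"
    unfolding torus_inner_parallelogram[of f "axis_step 1 k"] by (simp add: algebra_simps)
  ultimately show ?case
    using Suc[of ?P] Suc[of ?M] torus_inner_box_sum_Suc[of f k]
    by (simp del: box_sum.simps(2))
qed

lemma sum_PiE_lessThan_Suc:
  "(\<Sum>v\<in>(\<Pi>\<^sub>E i\<in>{..<Suc k}. A). F v) = (\<Sum>s\<in>A. \<Sum>v\<in>(\<Pi>\<^sub>E i\<in>{..<k}. A). F (v(k := s)))"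
proof -
  have "inj_on (\<lambda>(s, v). v(k := s)) (A \<times> (\<Pi>\<^sub>E i\<in>{..<k}. A))"
    by (rule inj_combinator) simp
  then show ?thesis
    unfolding lessThan_Suc PiE_insert_eq
    by (simp add: sum.reindex sum.cartesian_product o_def case_prod_unfold)
qed

lemma box_sum_eq_sum:
  assumes "k \<le> d" "p \<in> torus d n"
  shows "box_sum k f p =
    (\<Sum>v\<in>(\<Pi>\<^sub>E i\<in>{..<k}. {-1, 0, 1}). f (p \<oplus> (\<lambda>j. if j < k then v j else 0)))"
  using assms
proof (induction k arbitrary: p)
  case 0
  then show ?case by (simp add: translate_zero)
next
  case (Suc k)
  let ?pad = "\<lambda>k v j. if j < k then v j else 0 :: int"
  have step: "box_sum k f (p \<oplus> axis_step s k) =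
      (\<Sum>v\<in>(\<Pi>\<^sub>E i\<in>{..<k}. {-1, 0, 1}). f (p \<oplus> ?pad (Suc k) (v(k := s))))" for s
  proof -
    have "p \<oplus> axis_step s k \<oplus> ?pad k v = p \<oplus> ?pad (Suc k) (v(k := s))" for v
      unfolding translate_translate by (rule translate_cong) auto
    then show ?thesis using Suc by (simp add: translate_in_torus)
  qed
  have "box_sum (Suc k) f p = (\<Sum>s\<in>{-1, 0, 1}. box_sum k f (p \<oplus> axis_step s k))"
    using translate_zero[OF Suc.prems(2), of "axis_step 0 k"] by simp
  then show ?case unfolding step sum_PiE_lessThan_Suc .
qed

definition cut_edges :: "((nat \<Rightarrow> int) \<Rightarrow> bool) \<Rightarrow> ((nat \<Rightarrow> int) \<times> (nat \<Rightarrow> int)) set" where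
  "cut_edges c = {(p, v) \<in> torus d n \<times> directions d. c p \<noteq> c (p \<oplus> v)}"

lemma card_cut_edges:
  "card (cut_edges c) =
    (\<Sum>p\<in>torus d n. \<Sum>v\<in>(\<Pi>\<^sub>E i\<in>{..<d}. {-1, 0, 1}). of_bool (c p \<noteq> c (p \<oplus> v)))"
proof -
  have "c (p \<oplus> (\<lambda>i\<in>{..<d}. 0)) = c p" if "p \<in> torus d n" for p
    using translate_zero[OF that, of "\<lambda>i\<in>{..<d}. 0"] by simp
  then have "cut_edges c =
      (SIGMA p:torus d n. {v \<in> \<Pi>\<^sub>E i\<in>{..<d}. {-1, 0, 1}. c p \<noteq> c (p \<oplus> v)})"
    by (auto simp: cut_edges_def directions_def)
  then show ?thesis
    by (simp add: card_SigmaI finite_torus finite_PiE Int_def)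
qed

lemma torus_inner_sign_box_sum:
  fixes c :: "(nat \<Rightarrow> int) \<Rightarrow> bool"
  defines "f \<equiv> \<lambda>p. if c p then 1 else -1"
  shows "torus_inner f (box_sum d f)
    = 3 ^ d * real (card (torus d n)) - 2 * real (card (cut_edges c))"
proof -
  let ?V = "\<Pi>\<^sub>E i\<in>{..<d}. {-1, 0, 1 :: int}"
  have "f p * box_sum d f p = (\<Sum>v\<in>?V. 1 - 2 * of_bool (c p \<noteq> c (p \<oplus> v)))"
    if "p \<in> torus d n" for p
  proof -
    have box_sum_eq: "box_sum d f p = (\<Sum>v\<in>?V. f (p \<oplus> v))"
      unfolding box_sum_eq_sum[OF order_refl that]
      by (intro sum.cong refl arg_cong[where f = f] translate_cong) auto
    show ?thesis
      unfolding box_sum_eq sum_distrib_left by (intro sum.cong refl) (simp add: f_def)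
  qed
  then have "torus_inner f (box_sum d f) =
      (\<Sum>p\<in>torus d n. \<Sum>v\<in>?V. 1 - 2 * of_bool (c p \<noteq> c (p \<oplus> v)))"
    by (simp add: torus_inner_def del: sum_of_bool_eq)
  also have "\<dots> = 3 ^ d * real (card (torus d n)) - 2 * real (card (cut_edges c))"
    unfolding card_cut_edges sum_subtractf sum_distrib_left[symmetric]
    by (simp add: card_PiE numeral_3_eq_3 del: sum_of_bool_eq)
  finally show ?thesis .
qed

lemma card_cut_edges_le:
  assumes "0 < d"
  shows "card (cut_edges c) \<le> 2 * 3 ^ (d - 1) * card (torus d n)"
proof -
  let ?f = "\<lambda>p. if c p then 1 else -1 :: real"
  have "torus_inner ?f ?f = (\<Sum>p\<in>torus d n. 1)"
    unfolding torus_inner_def by (rule sum.cong) auto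
  then have "- (3 ^ d / 3) * real (card (torus d n))
      \<le> 3 ^ d * real (card (torus d n)) - 2 * real (card (cut_edges c))"
    using torus_inner_box_sum_bounds[of d ?f] torus_inner_sign_box_sum[of c] by simp
  moreover have "(3::real) ^ d = 3 * 3 ^ (d - 1)"
    using assms by (simp add: power_eq_if)
  ultimately have "real (card (cut_edges c)) \<le> real (2 * 3 ^ (d - 1) * card (torus d n))"
    by (simp add: algebra_simps)
  then show ?thesis by (simp only: of_nat_le_iff)
qed

lemma symmetric_edges_cut: "symmetric_edges d n (cut_edges c)"
  by unfold_locales
     (auto simp: cut_edges_def translate_in_torus opposite_in_directions translate_opposite)

end

section \<open>Words whose letters determine the parity of the index\<close>

definition parity_separated :: "'a list \<Rightarrow> bool" where
  "parity_separated w \<longleftrightarrow> (\<forall>i<length w. \<forall>j<length w. odd i \<and> even j \<longrightarrow> w ! i \<noteq> w ! j)"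

lemma parity_separated_iff_odd:
  assumes "parity_separated w" "i < length w"
  shows "(\<exists>j<length w. odd j \<and> w ! j = w ! i) \<longleftrightarrow> odd i"
  using assms unfolding parity_separated_def by metis

lemma (in discrete_torus) appearances_parity_separated_le:
  assumes "is_word w" "parity_separated w" "0 < d"
  shows "real (card (appearances d n \<Gamma> w))
    \<le> 3 ^ (d - 1) * concentration 1 w * real (card (torus d n))"
proof -
  define c where "c p \<longleftrightarrow> (\<exists>j<length w. odd j \<and> w ! j = \<Gamma> p)" for p
  interpret symmetric_edges d n "cut_edges c" by (rule symmetric_edges_cut)
  have "(walk d n p v i, v) \<in> cut_edges c"
    if "(p, v) \<in> appearances d n \<Gamma> w" "Suc i < length w" for p v i
  proof -
    have "c (walk d n p v j) \<longleftrightarrow> odd j" if "j < length w" for j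
      using \<open>(p, v) \<in> appearances d n \<Gamma> w\<close> that parity_separated_iff_odd[OF assms(2)]
      by (simp add: c_def mem_appearances starts_def spells_def)
    then show ?thesis
      using that by (simp add: cut_edges_def mem_appearances walk_in_torus flip: walk_Suc)
  qed
  then have "2 * real (card (appearances d n \<Gamma> w)) \<le> concentration 1 w * real (card (cut_edges c))"
    using is_word_length[OF assms(1)] by (intro appearances_along_edges_le)
  also have "\<dots> \<le> concentration 1 w * real (2 * 3 ^ (d - 1) * card (torus d n))"
    by (intro mult_left_mono concentration_nonneg)
       (simp only: of_nat_le_iff card_cut_edges_le assms(3))
  finally show ?thesis by (simp add: algebra_simps)
qed

lemma stackable_if_parity_separated:
  assumes "is_word w" "parity_separated w" "0 < d"
  shows "stackable d w"
  unfolding stackable_iff_le[OF assms(3)]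
  by (rule concentration_leI) (rule discrete_torus.appearances_parity_separated_le[OF _ assms])

section \<open>Repeating letters\<close>

lemma length_repeat_letters: "length (repeat_letters k w) = k * length w"
  by (induction w) (auto simp: repeat_letters_def)

lemma rev_repeat_letters: "rev (repeat_letters k w) = repeat_letters k (rev w)"
  by (simp add: repeat_letters_def rev_concat rev_map o_def)

lemma nth_repeat_letters:
  assumes "i < k * length w"
  shows "repeat_letters k w ! i = w ! (i div k)"
  using assms
proof (induction w arbitrary: i)
  case (Cons a w)
  have repeat_Cons: "repeat_letters k (a # w) = replicate k a @ repeat_letters k w"
    by (simp add: repeat_letters_def)
  show ?case
  proof (cases "i < k")
    case True
    then show ?thesis by (simp add: repeat_Cons nth_append)
  next
    case False
    then have "i div k = Suc ((i - k) div k)" using Cons.prems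
      by (intro le_div_geq) (auto intro: gr0I)
    then show ?thesis using False Cons by (simp add: repeat_Cons nth_append)
  qed
qed simp

lemma nth_repeat_letters_block:
  assumes "i < length w" "s < k"
  shows "k * i + s < k * length w" "repeat_letters k w ! (k * i + s) = w ! i"
proof -
  have "k * i + s < k * Suc i" using assms(2) by simp
  also have "\<dots> \<le> k * length w" using assms(1) by (intro mult_le_mono2) simp
  finally show "k * i + s < k * length w" .
  then show "repeat_letters k w ! (k * i + s) = w ! i"
    using assms(2) by (simp add: nth_repeat_letters)
qed

lemma spells_repeat_lettersD:
  "spells f (repeat_letters k w) \<Longrightarrow> s < k \<Longrightarrow> spells (\<lambda>i. f (k * i + s)) w"
  by (simp add: spells_def length_repeat_letters nth_repeat_letters_block)

lemma spells_repeat_lettersI: "spells f w \<Longrightarrow> spells (\<lambda>i. f (i div k)) (repeat_letters k w)"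
  by (simp add: spells_def length_repeat_letters nth_repeat_letters
      less_mult_imp_div_less mult.commute)

lemma repeat_letters_no_short_period:
  assumes "is_word w" "0 < \<delta>" "\<delta> < k"
  shows "\<not> has_period (repeat_letters k w) \<delta>"
proof
  assume period: "has_period (repeat_letters k w) \<delta>"
  have "w ! i = w ! (i + 1)" if in_word: "i + 1 < length w" for i
  proof -
    have "k * i + (k - \<delta>) + \<delta> = k * (i + 1) + 0" using assms(3) by simp
    moreover have "repeat_letters k w ! (k * i + (k - \<delta>)) = w ! i"
      using assms(2,3) in_word by (intro nth_repeat_letters_block) auto
    ultimately show ?thesis
      using period nth_repeat_letters_block[OF in_word, of 0 k] assms
      unfolding has_period_def length_repeat_letters by (metis order.strict_trans)
  qed
  then show False
    using is_word_no_period_1[OF assms(1)] unfolding has_period_def by blast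
qed

context discrete_torus
begin

lemma sum_card_translates:
  assumes subset: "S \<subseteq> torus d n \<times> D" and "finite D"
  shows "(\<Sum>q\<in>torus d n. card {(x, v) \<in> torus d n \<times> D. (q \<oplus> u x, v) \<in> S})
    = card (torus d n) * card S"
proof -
  let ?T = "torus d n"
  have card_eq_sum: "card {(x, v) \<in> ?T \<times> D. P x v} = (\<Sum>x\<in>?T. \<Sum>v\<in>D. of_bool (P x v))" for P
  proof -
    have "{(x, v) \<in> ?T \<times> D. P x v} = (SIGMA x:?T. {v \<in> D. P x v})" by auto
    then show ?thesis by (simp add: card_SigmaI finite_torus \<open>finite D\<close> Int_def)
  qed
  have "(\<Sum>q\<in>?T. card {(x, v) \<in> ?T \<times> D. (q \<oplus> u x, v) \<in> S})
      = (\<Sum>x\<in>?T. \<Sum>q\<in>?T. \<Sum>v\<in>D. of_bool ((q \<oplus> u x, v) \<in> S))"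
    unfolding card_eq_sum by (rule sum.swap)
  also have "\<dots> = (\<Sum>x\<in>?T. \<Sum>q\<in>?T. \<Sum>v\<in>D. of_bool ((q, v) \<in> S))"
    by (rule sum.cong[OF refl]) (rule sum_translate)
  also have "\<dots> = (\<Sum>x\<in>?T. card S)"
  proof -
    have "S = {(x, v) \<in> ?T \<times> D. (x, v) \<in> S}" using subset by auto
    then show ?thesis using card_eq_sum[of "\<lambda>x v. (x, v) \<in> S"] by simp
  qed
  finally show ?thesis by simp
qed

lemma translate_scaled_walk:
  "q \<oplus> (\<lambda>j. int k * walk d n x v i j) = walk d n (q \<oplus> (\<lambda>j. int k * x j)) v (k * i)"
proof -
  have "(q j + int k * ((x j + int i * v j) mod int (n j))) mod int (n j)
      = (q j + int k * (x j + int i * v j)) mod int (n j)" for j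
    by (metis mod_add_right_eq mod_mult_right_eq)
  then show ?thesis
    unfolding walk_eq_translate translate_translate unfolding translate_def
    by (intro restrict_ext) (simp add: algebra_simps)
qed

text \<open>The map \<open>x \<mapsto> q + k x\<close> turns spaced appearances into ordinary ones; averaging over \<open>q\<close> makes
  up for its not being a bijection.\<close>

lemma spaced_appearances_le_concentration:
  "real (card {(p, v) \<in> torus d n \<times> directions d. spells (\<lambda>i. \<Gamma> (walk d n p v (k * i))) w})
    \<le> concentration d w * real (card (torus d n))" (is "real (card ?S) \<le> _")
proof -
  let ?T = "torus d n" and ?G = "\<lambda>q x. \<Gamma> (q \<oplus> (\<lambda>j. int k * x j))"
  have appearances: "appearances d n (?G q) w =
      {(x, v) \<in> ?T \<times> directions d. (q \<oplus> (\<lambda>j. int k * x j), v) \<in> ?S}" for q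
    by (auto simp: mem_appearances starts_def translate_scaled_walk translate_in_torus)
  have "real (card ?T) * real (card ?S) = (\<Sum>q\<in>?T. real (card (appearances d n (?G q) w)))"
    unfolding appearances of_nat_sum[symmetric]
    by (subst sum_card_translates) (auto simp: finite_directions)
  also have "\<dots> \<le> (\<Sum>q\<in>?T. concentration d w * real (card ?T))"
    by (intro sum_mono appearances_le_concentration)
  finally have "real (card ?T) * real (card ?S)
      \<le> real (card ?T) * (concentration d w * real (card ?T))"
    by simp
  then show ?thesis using card_torus_pos by simp
qed

lemma card_appearances_repeat_letters_le:
  assumes "is_word w"
  shows "k * card (appearances d n \<Gamma> (repeat_letters k w))
    \<le> card {(p, v) \<in> torus d n \<times> directions d. spells (\<lambda>i. \<Gamma> (walk d n p v (k * i))) w}"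
    (is "_ * card ?A \<le> card ?S")
proof -
  let ?f = "\<lambda>((p, v), s). (walk d n p v s, v)"
  have "?f ((p, v), s) \<in> ?S" if "(p, v) \<in> ?A" "s < k" for p v s
  proof -
    have "spells (\<lambda>i. \<Gamma> (walk d n p v (k * i + s))) w"
      using that by (intro spells_repeat_lettersD) (auto simp: mem_appearances starts_def)
    then show ?thesis
      using that by (simp add: mem_appearances walk_in_torus walk_walk add.commute)
  qed
  then have "?f ` (?A \<times> {..<k}) \<subseteq> ?S" by auto
  moreover have "inj_on ?f (?A \<times> {..<k})"
    by (rule inj_on_walk_appearances) (rule repeat_letters_no_short_period[OF assms])
  moreover have "finite ?S"
    by (rule finite_subset[of _ "torus d n \<times> directions d"])
       (auto simp: finite_torus finite_directions)
  ultimately have "card (?A \<times> {..<k}) \<le> card ?S" by (intro card_inj_on_le)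
  then show ?thesis by (simp add: card_cartesian_product mult.commute)
qed

end

lemma concentration_repeat_letters_le:
  assumes "is_word w" "0 < k"
  shows "concentration d (repeat_letters k w) \<le> concentration d w / real k"
proof (rule concentration_leI)
  fix n and \<Gamma> :: "(nat \<Rightarrow> int) \<Rightarrow> 'a" assume "discrete_torus d n"
  then interpret discrete_torus d n .
  have "real (k * card (appearances d n \<Gamma> (repeat_letters k w)))
      \<le> real (card {(p, v) \<in> torus d n \<times> directions d. spells (\<lambda>i. \<Gamma> (walk d n p v (k * i))) w})"
    by (rule of_nat_mono) (rule card_appearances_repeat_letters_le[OF assms(1)])
  also have "\<dots> \<le> concentration d w * real (card (torus d n))"
    by (rule spaced_appearances_le_concentration)
  finally show "real (card (appearances d n \<Gamma> (repeat_letters k w)))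
      \<le> concentration d w / real k * real (card (torus d n))"
    using assms(2) by (simp add: field_simps)
qed

lemma card_cyclic_hits_repeat_letters:
  assumes "0 < k"
  shows "card (cyclic_hits m h w)
    \<le> card (cyclic_hits (k * m) (\<lambda>x. h (x div k)) (repeat_letters k w))"
proof (rule card_inj_on_le[OF _ _ finite_cyclic_hits])
  show "inj_on (\<lambda>x. k * x) (cyclic_hits m h w)" using assms by (auto simp: inj_on_def)
  show "(\<lambda>x. k * x) ` cyclic_hits m h w
      \<subseteq> cyclic_hits (k * m) (\<lambda>x. h (x div k)) (repeat_letters k w)"
  proof (rule image_subsetI)
    fix x assume hit: "x \<in> cyclic_hits m h w"
    have "(k * x + i) mod (k * m) div k = (x + i div k) mod m" for i
      using assms by (simp add: mod_mult2_eq)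
    then have "spells (\<lambda>i. h ((k * x + i) mod (k * m) div k)) (repeat_letters k w)"
      using hit spells_repeat_lettersI[of "\<lambda>i. h ((x + i) mod m)" w k]
      by (simp add: cyclic_hits_def)
    then show "k * x \<in> cyclic_hits (k * m) (\<lambda>x. h (x div k)) (repeat_letters k w)"
      using hit assms by (simp add: cyclic_hits_def)
  qed
qed

lemma concentration_1_le_repeat_letters:
  assumes "0 < k"
  shows "concentration 1 w \<le> real k * concentration 1 (repeat_letters k w)"
proof (rule concentration_1_leI)
  fix m :: nat and h :: "nat \<Rightarrow> 'a" assume "0 < m"
  let ?h = "\<lambda>x. h (x div k)" and ?w = "repeat_letters k w"
  have "real (card (cyclic_hits m h w) + card (cyclic_hits m h (rev w)))
      \<le> real (card (cyclic_hits (k * m) ?h ?w) + card (cyclic_hits (k * m) ?h (rev ?w)))"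
    unfolding rev_repeat_letters using card_cyclic_hits_repeat_letters[OF assms]
    by (intro of_nat_mono add_mono)
  also have "\<dots> \<le> concentration 1 ?w * real (k * m)"
    using cyclic_hits_le_concentration[of 1 "k * m" ?h ?w] assms \<open>0 < m\<close> by simp
  finally show "real (card (cyclic_hits m h w) + card (cyclic_hits m h (rev w)))
      \<le> real k * concentration 1 ?w * real m"
    by (simp add: algebra_simps)
qed

lemma stackable_repeat_letters:
  assumes "is_word w" "0 < d" "0 < k" "stackable d w"
  shows "stackable d (repeat_letters k w)"
proof -
  have "concentration d (repeat_letters k w) \<le> concentration d w / real k"
    by (rule concentration_repeat_letters_le) fact+
  also have "\<dots> = 3 ^ (d - 1) * concentration 1 w / real k"
    using assms(4) by (simp add: stackable_def)
  also have "\<dots> \<le> 3 ^ (d - 1) * concentration 1 (repeat_letters k w)"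
    using concentration_1_le_repeat_letters[OF assms(3), of w] assms(3) by (simp add: field_simps)
  finally show ?thesis using stackable_iff_le[OF assms(2)] by blast
qed

section \<open>Windows in two-dimensional grids\<close>

definition plane_vec :: "int \<Rightarrow> int \<Rightarrow> nat \<Rightarrow> int" where
  "plane_vec a b = (\<lambda>j\<in>{..<2}. if j = 0 then a else b)"

lemma plane_vec_apply: "plane_vec a b 0 = a" "plane_vec a b (Suc 0) = b"
  by (simp_all add: plane_vec_def)

lemma plane_vec_eq_iff: "plane_vec a b = plane_vec a' b' \<longleftrightarrow> a = a' \<and> b = b'"
  by (metis plane_vec_apply)

lemma directions_2:
  "directions 2 = {plane_vec 1 1, plane_vec 1 0, plane_vec (-1) 1, plane_vec 0 1,
     plane_vec (-1) (-1), plane_vec (-1) 0, plane_vec 1 (-1), plane_vec 0 (-1)}" (is "_ = ?D")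
proof
  show "directions 2 \<subseteq> ?D"
  proof
    fix v assume direction: "v \<in> directions 2"
    then have "v = plane_vec (v 0) (v 1)"
      by (auto simp: directions_def PiE_iff extensional_def plane_vec_def fun_eq_iff
          less_2_cases_iff)
    moreover have "v 0 \<in> {-1, 0, 1}" "v 1 \<in> {-1, 0, 1}"
      using direction by (auto simp: directions_def PiE_iff)
    moreover have "plane_vec 0 0 = (\<lambda>i\<in>{..<2}. 0)" by (simp add: plane_vec_def)
    then have "plane_vec 0 0 \<notin> directions 2" by (simp add: directions_def)
    ultimately show "v \<in> ?D" using direction by (metis insert_iff singletonD)
  qed
  have "plane_vec a b \<in> directions 2" if "a \<in> {-1, 0, 1}" "b \<in> {-1, 0, 1}" "a \<noteq> 0 \<or> b \<noteq> 0" for a b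
  proof -
    have "plane_vec a b \<noteq> (\<lambda>i\<in>{..<2}. 0)"
      using that(3) plane_vec_eq_iff[of a b 0 0] by (simp add: plane_vec_def)
    then show ?thesis using that by (auto simp: directions_def plane_vec_def)
  qed
  then show "?D \<subseteq> directions 2" by simp
qed

lemma card_directions_2: "card (directions 2) = 8"
  by (simp add: directions_2 plane_vec_eq_iff)

definition rotation_sum :: "((int \<Rightarrow> int \<Rightarrow> 'a) \<Rightarrow> int) \<Rightarrow> (int \<Rightarrow> int \<Rightarrow> 'a) \<Rightarrow> int" where
  "rotation_sum F z = F z + F (\<lambda>s t. z (- t) s) + F (\<lambda>s t. z (- s) (- t)) + F (\<lambda>s t. z t (- s))"

definition central_triples :: "('a \<Rightarrow> 'a \<Rightarrow> 'a \<Rightarrow> bool) \<Rightarrow> (int \<Rightarrow> int \<Rightarrow> 'a) \<Rightarrow> int" where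
  "central_triples P = rotation_sum (\<lambda>z.
     of_bool (P (z (-1) (-1)) (z 0 0) (z 1 1)) + of_bool (P (z (-1) 0) (z 0 0) (z 1 0)))"

definition window :: "(nat \<Rightarrow> nat) \<Rightarrow> ((nat \<Rightarrow> int) \<Rightarrow> 'a) \<Rightarrow> (nat \<Rightarrow> int) \<Rightarrow> int \<Rightarrow> int \<Rightarrow> 'a" where
  "window n \<Gamma> p s t = \<Gamma> (translate 2 n p (plane_vec s t))"

locale plane_torus = discrete_torus 2 n for n
begin

lemma window_translate:
  "window n \<Gamma> (translate 2 n p (plane_vec a b)) s t = window n \<Gamma> p (s + a) (t + b)"
  unfolding window_def translate_translate
  by (intro arg_cong[where f = \<Gamma>] translate_cong) (auto simp: less_2_cases_iff plane_vec_apply)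

lemma window_walk: "window n \<Gamma> p (int i * s) (int i * t) = \<Gamma> (walk 2 n p (plane_vec s t) i)"
  unfolding window_def walk_eq_translate
  by (intro arg_cong[where f = \<Gamma>] translate_cong) (auto simp: less_2_cases_iff plane_vec_apply)

lemma sum_window_shift:
  "(\<Sum>p\<in>torus 2 n. F (\<lambda>s t. window n \<Gamma> p (s + a) (t + b))) = (\<Sum>p\<in>torus 2 n. F (window n \<Gamma> p))"
  using sum_translate[of "\<lambda>p. F (window n \<Gamma> p)" "plane_vec a b"]
  by (simp add: window_translate[abs_def])

lemma sum_window_1:
  "(\<Sum>p\<in>torus 2 n. f (window n \<Gamma> p s t)) = (\<Sum>p\<in>torus 2 n. f (window n \<Gamma> p 0 0))"
  using sum_window_shift[of "\<lambda>z. f (z 0 0)" \<Gamma> s t] by simp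

lemma sum_window_2:
  "(\<Sum>p\<in>torus 2 n. f (window n \<Gamma> p s t) (window n \<Gamma> p s' t')) =
   (\<Sum>p\<in>torus 2 n. f (window n \<Gamma> p 0 0) (window n \<Gamma> p (s' - s) (t' - t)))"
  using sum_window_shift[of "\<lambda>z. f (z 0 0) (z (s' - s) (t' - t))" \<Gamma> s t] by simp

lemma sum_window_3:
  "(\<Sum>p\<in>torus 2 n. f (window n \<Gamma> p s t) (window n \<Gamma> p s' t') (window n \<Gamma> p s'' t'')) =
   (\<Sum>p\<in>torus 2 n. f (window n \<Gamma> p 0 0) (window n \<Gamma> p (s' - s) (t' - t))
     (window n \<Gamma> p (s'' - s) (t'' - t)))"
  using sum_window_shift[of "\<lambda>z. f (z 0 0) (z (s' - s) (t' - t)) (z (s'' - s) (t'' - t))" \<Gamma> s t]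
  by simp

lemma card_starts_le_triples:
  assumes "0 < r" "Suc r < length w" "P (w ! (r - 1)) (w ! r) (w ! Suc r)"
  shows "int (card (starts 2 n \<Gamma> w (plane_vec s t))) \<le> (\<Sum>p\<in>torus 2 n.
    of_bool (P (window n \<Gamma> p (- s) (- t)) (window n \<Gamma> p 0 0) (window n \<Gamma> p s t)))"
proof -
  let ?W = "\<lambda>p i. window n \<Gamma> p (int i * s) (int i * t)"
  have "int (card (starts 2 n \<Gamma> w (plane_vec s t)))
      = (\<Sum>p\<in>torus 2 n. of_bool (spells (\<lambda>i. ?W p i) w))"
    by (simp add: starts_def window_walk finite_torus Int_def)
  also have "\<dots> \<le> (\<Sum>p\<in>torus 2 n. of_bool (P (?W p (r - 1)) (?W p r) (?W p (Suc r))))"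
  proof (rule sum_mono)
    fix p
    show "of_bool (spells (\<lambda>i. ?W p i) w)
        \<le> (of_bool (P (?W p (r - 1)) (?W p r) (?W p (Suc r))) :: int)"
      using assms spells_nth[of "\<lambda>i. ?W p i" w r] spells_nth[of "\<lambda>i. ?W p i" w "r - 1"]
        spells_nth[of "\<lambda>i. ?W p i" w "Suc r"]
      by (auto simp del: of_nat_Suc)
  qed
  also have "\<dots> = (\<Sum>p\<in>torus 2 n.
      of_bool (P (window n \<Gamma> p (- s) (- t)) (window n \<Gamma> p 0 0) (window n \<Gamma> p s t)))"
    using sum_window_shift[of "\<lambda>z. of_bool (P (z (- s) (- t)) (z 0 0) (z s t)) :: int" \<Gamma>
        "int r * s" "int r * t"] assms(1)
    by (simp add: of_nat_diff algebra_simps del: sum_of_bool_eq)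
  finally show ?thesis .
qed

lemma card_appearances_le_central_triples:
  assumes "0 < r" "Suc r < length w" "P (w ! (r - 1)) (w ! r) (w ! Suc r)"
  shows "int (card (appearances 2 n \<Gamma> w)) \<le> (\<Sum>p\<in>torus 2 n. central_triples P (window n \<Gamma> p))"
proof -
  note triples = card_starts_le_triples[of r w P, OF assms, of \<Gamma>]
  have "int (card (appearances 2 n \<Gamma> w)) =
      (\<Sum>v\<in>directions 2. int (card (starts 2 n \<Gamma> w v)))"
    by (simp add: card_appearances)
  also have "\<dots> \<le> (\<Sum>p\<in>torus 2 n. central_triples P (window n \<Gamma> p))"
    using triples[of 1 1] triples[of 1 0] triples[of "-1" 1] triples[of 0 1]
      triples[of "-1" "-1"] triples[of "-1" 0] triples[of 1 "-1"] triples[of 0 "-1"]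
    unfolding central_triples_def rotation_sum_def directions_2
    by (simp add: plane_vec_eq_iff sum.distrib del: sum_of_bool_eq)
  finally show ?thesis .
qed

end

text \<open>The balances below are dual certificates of the linear program that maximises the number of
  counted words over shift-invariant distributions on \<open>3 \<times> 3\<close> windows: every parenthesis is a sum of
  differences between a product and a translate of it, so that it vanishes when summed over all
  windows of a torus.\<close>

definition AAB_balance :: "'a \<Rightarrow> (int \<Rightarrow> int \<Rightarrow> 'a) \<Rightarrow> int" where
  "AAB_balance A z = (let x = \<lambda>s t. of_bool (z s t = A) in
      5 * (x 0 0 - x 1 1)
      + 3 * (2 * (x 0 0 * x 1 0) - x 0 1 * x 1 1 - x 0 (-1) * x 1 (-1))
      + (x (-1) 0 * x 0 1 - x 0 0 * x 1 1)
      + (x (-1) 1 * x 1 1 - x (-1) 0 * x 1 0)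
      + (x (-1) 0 * x 0 1 * x 1 0 - x (-1) (-1) * x 0 0 * x 1 (-1))
      + 6 * (x (-1) 1 * x 0 1 * x 1 1 - x (-1) 0 * x 0 0 * x 1 0))"

lemma central_triples_AAB_le:
  "9 * central_triples (\<lambda>x y z. x = A \<and> y = A \<and> z \<noteq> A) z \<le> 18 + rotation_sum (AAB_balance A) z"
proof -
  define x where "x s t = (of_bool (z s t = A) :: int)" for s t
  have x_0_1: "x s t = 0 \<or> x s t = 1" for s t by (simp add: x_def)
  show ?thesis
    unfolding central_triples_def rotation_sum_def AAB_balance_def Let_def
      of_bool_conj of_bool_not_iff x_def[symmetric] minus_minus minus_zero
    by (rule disjE[OF x_0_1[of 0 0]]; simp?;
        rule disjE[OF x_0_1[of "-1" 0]]; simp?; rule disjE[OF x_0_1[of 0 1]]; simp?;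
        rule disjE[OF x_0_1[of 1 0]]; simp?; rule disjE[OF x_0_1[of 0 "-1"]]; simp?;
        rule disjE[OF x_0_1[of "-1" "-1"]]; simp?; rule disjE[OF x_0_1[of "-1" 1]]; simp?;
        rule disjE[OF x_0_1[of 1 1]]; simp?; rule disjE[OF x_0_1[of 1 "-1"]]; simp?)
qed

lemma (in plane_torus) sum_AAB_balance:
  "(\<Sum>p\<in>torus 2 n. rotation_sum (AAB_balance A) (window n \<Gamma> p)) = 0"
proof -
  define x where "x p s t = (of_bool (window n \<Gamma> p s t = A) :: int)" for p s t
  define moment1 where "moment1 = (\<Sum>p\<in>torus 2 n. x p 0 0)"
  define moment2 where "moment2 s t = (\<Sum>p\<in>torus 2 n. x p 0 0 * x p s t)" for s t
  define moment3 where "moment3 s t s' t' = (\<Sum>p\<in>torus 2 n. x p 0 0 * x p s t * x p s' t')"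
    for s t s' t'
  have "(\<Sum>p\<in>torus 2 n. x p a b) = moment1" for a b
    unfolding moment1_def x_def by (rule sum_window_1)
  moreover have "(\<Sum>p\<in>torus 2 n. x p a b * x p s t) = moment2 (s - a) (t - b)" for a b s t
    unfolding moment2_def x_def by (rule sum_window_2)
  moreover have "(\<Sum>p\<in>torus 2 n. x p a b * x p s t * x p s' t')
      = moment3 (s - a) (t - b) (s' - a) (t' - b)" for a b s t s' t'
    unfolding moment3_def x_def by (rule sum_window_3)
  ultimately show ?thesis
    unfolding rotation_sum_def AAB_balance_def Let_def x_def[symmetric] minus_minus minus_zero
      sum.distrib sum_subtractf sum_distrib_left[symmetric] by simp
qed

lemma concentration_2_AAB_le:
  assumes "A \<noteq> B"
  shows "concentration 2 [A, A, B] \<le> 2"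
proof (rule concentration_leI)
  fix n and \<Gamma> :: "(nat \<Rightarrow> int) \<Rightarrow> 'a" assume "discrete_torus 2 n"
  then interpret plane_torus n by (rule plane_torus.intro)
  have "9 * int (card (appearances 2 n \<Gamma> [A, A, B]))
      \<le> (\<Sum>p\<in>torus 2 n. 9 * central_triples (\<lambda>x y z. x = A \<and> y = A \<and> z \<noteq> A) (window n \<Gamma> p))"
    unfolding sum_distrib_left[symmetric]
    using assms card_appearances_le_central_triples[of 1 "[A, A, B]"] by simp
  also have "\<dots> \<le> (\<Sum>p\<in>torus 2 n. 18 + rotation_sum (AAB_balance A) (window n \<Gamma> p))"
    by (intro sum_mono central_triples_AAB_le)
  also have "\<dots> = 18 * int (card (torus 2 n))"
    by (simp add: sum.distrib sum_AAB_balance)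
  finally show "real (card (appearances 2 n \<Gamma> [A, A, B])) \<le> 2 * real (card (torus 2 n))"
    by linarith
qed

definition AABC_balance :: "'a \<Rightarrow> 'a \<Rightarrow> (int \<Rightarrow> int \<Rightarrow> 'a) \<Rightarrow> int" where
  "AABC_balance A C z = (let a = \<lambda>s t. of_bool (z s t = A); c = \<lambda>s t. of_bool (z s t = C) in
      6 * (a (-1) 1 * a 1 1 - a (-1) 0 * a 1 0)
      + 2 * (a (-1) 0 * a 0 1 - a 0 0 * a 1 1)
      + 3 * (c 1 1 * a 0 1 + c 1 (-1) * a 0 (-1) - 2 * (c 1 0 * a 0 0))
      + 4 * (c 0 1 * a (-1) 0 + c 1 0 * a 0 (-1) - 2 * (c 1 1 * a 0 0))
      + 5 * (c 1 1 - c 0 0)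
      + 3 * (c 0 1 * c 1 1 + c 0 (-1) * c 1 (-1) - 2 * (c 0 0 * c 1 0))
      + 2 * (c (-1) 1 * c 1 1 - c (-1) 0 * c 1 0)
      + 4 * (c (-1) 0 * c 0 1 - c 0 0 * c 1 1))"

lemma (in plane_torus) sum_AABC_balance:
  "(\<Sum>p\<in>torus 2 n. rotation_sum (AABC_balance A C) (window n \<Gamma> p)) = 0"
proof -
  define a where "a p s t = (of_bool (window n \<Gamma> p s t = A) :: int)" for p s t
  define c where "c p s t = (of_bool (window n \<Gamma> p s t = C) :: int)" for p s t
  define moment1 where "moment1 = (\<Sum>p\<in>torus 2 n. c p 0 0)"
  define moment2 where "moment2 f g s t = (\<Sum>p\<in>torus 2 n. f p 0 0 * g p s t)"
    for f g :: "(nat \<Rightarrow> int) \<Rightarrow> int \<Rightarrow> int \<Rightarrow> int" and s t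
  have "(\<Sum>p\<in>torus 2 n. c p s t) = moment1" for s t
    unfolding moment1_def c_def by (rule sum_window_1)
  moreover have "(\<Sum>p\<in>torus 2 n. a p s t * a p s' t') = moment2 a a (s' - s) (t' - t)"
    and "(\<Sum>p\<in>torus 2 n. c p s t * a p s' t') = moment2 c a (s' - s) (t' - t)"
    and "(\<Sum>p\<in>torus 2 n. c p s t * c p s' t') = moment2 c c (s' - s) (t' - t)" for s t s' t'
    unfolding moment2_def a_def c_def by (rule sum_window_2)+
  ultimately show ?thesis
    unfolding rotation_sum_def AABC_balance_def Let_def a_def[symmetric] c_def[symmetric]
      minus_minus minus_zero sum.distrib sum_subtractf sum_distrib_left[symmetric] by simp
qed

definition letter_codes :: "(int \<times> int) set" where
  "letter_codes = {(0, 0), (1, 0), (0, 1)}"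

lemma letter_codes_cases:
  assumes "(a, c) \<in> letter_codes"
  obtains "a = 0" "c = 0" | "a = 1" "c = 0" | "a = 0" "c = 1"
  using assms by (auto simp: letter_codes_def)

text \<open>In the next six lemmas the four corners, or the four edge cells, of the window are numbered in
  cyclic order; \<open>a\<close> and \<open>c\<close> are the indicators of \<open>A\<close> and \<open>C\<close>, every other letter counting as \<open>B\<close>.
  The two parts interact only through \<open>q\<close>, which marks the edge cells that are not \<open>B\<close>.\<close>

lemma corners_around_A_le:
  assumes "(a1, c1) \<in> letter_codes" "(a2, c2) \<in> letter_codes" "(a3, c3) \<in> letter_codes"
    "(a4, c4) \<in> letter_codes" and "0 \<le> q1" "0 \<le> q2" "0 \<le> q3" "0 \<le> q4"
  shows "10 * (a1 * (1 - a3 - c3) + a3 * (1 - a1 - c1) + a2 * (1 - a4 - c4) + a4 * (1 - a2 - c2))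
    + 2 * (a1 + a2 + a3 + a4) + 3 * (c1 + c2 + c3 + c4)
    \<le> 18 + 3 * (c1 * (q4 + q1) + c2 * (q1 + q2) + c3 * (q2 + q3) + c4 * (q3 + q4))
      + 6 * (a1 * a2 + a2 * a3 + a3 * a4 + a4 * a1) + 2 * (c1 * c2 + c2 * c3 + c3 * c4 + c4 * c1)"
  by (insert assms(5-8), rule letter_codes_cases[OF assms(1)]; simp?;
      rule letter_codes_cases[OF assms(2)]; simp?;
      rule letter_codes_cases[OF assms(3)]; simp?;
      rule letter_codes_cases[OF assms(4)]; simp?)

lemma edges_around_A_le:
  assumes "(a1, c1) \<in> letter_codes" "(a2, c2) \<in> letter_codes" "(a3, c3) \<in> letter_codes"
    "(a4, c4) \<in> letter_codes"
  shows "10 * (a1 * (1 - a3 - c3) + a3 * (1 - a1 - c1) + a2 * (1 - a4 - c4) + a4 * (1 - a2 - c2))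
    + 6 * (c1 + c2 + c3 + c4) + 12 * (a1 * a3 + a2 * a4) + 4 * (c1 * c3 + c2 * c4)
    \<le> 18 + 2 * (a1 * a2 + a2 * a3 + a3 * a4 + a4 * a1) + 4 * (a1 * c2 + a2 * c3 + a3 * c4 + a4 * c1)
      + 4 * (c1 * a2 + c2 * a3 + c3 * a4 + c4 * a1) + 4 * (c1 * c2 + c2 * c3 + c3 * c4 + c4 * c1)"
  by (rule letter_codes_cases[OF assms(1)]; simp?;
      rule letter_codes_cases[OF assms(2)]; simp?;
      rule letter_codes_cases[OF assms(3)]; simp?;
      rule letter_codes_cases[OF assms(4)]; simp?)

lemma corners_around_B_le:
  fixes q1 q2 q3 q4 :: int
  assumes "(a1, c1) \<in> letter_codes" "(a2, c2) \<in> letter_codes" "(a3, c3) \<in> letter_codes"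
    "(a4, c4) \<in> letter_codes" and
    "q1 = 0 \<or> q1 = 1" "q2 = 0 \<or> q2 = 1" "q3 = 0 \<or> q3 = 1" "q4 = 0 \<or> q4 = 1"
  shows "20 * (a1 * c3 + a3 * c1 + a2 * c4 + a4 * c2)
    \<le> 22 - 6 * (q1 * q3 + q2 * q4)
      + c1 * (5 + 3 * (q4 + q1)) + c2 * (5 + 3 * (q1 + q2))
      + c3 * (5 + 3 * (q2 + q3)) + c4 * (5 + 3 * (q3 + q4))
      + 6 * (a1 * a2 + a2 * a3 + a3 * a4 + a4 * a1) + 2 * (c1 * c2 + c2 * c3 + c3 * c4 + c4 * c1)"
  by (rule disjE[OF assms(5)]; simp?;
      rule disjE[OF assms(6)]; simp?;
      rule disjE[OF assms(7)]; simp?;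
      rule disjE[OF assms(8)]; simp?;
      rule letter_codes_cases[OF assms(1)]; simp?;
      rule letter_codes_cases[OF assms(2)]; simp?;
      rule letter_codes_cases[OF assms(3)]; simp?;
      rule letter_codes_cases[OF assms(4)]; simp?)

lemma edges_around_B_le:
  assumes "(a1, c1) \<in> letter_codes" "(a2, c2) \<in> letter_codes" "(a3, c3) \<in> letter_codes"
    "(a4, c4) \<in> letter_codes"
  shows "20 * (a1 * c3 + a3 * c1 + a2 * c4 + a4 * c2)
    + 12 * (a1 * a3 + a2 * a4) + 4 * (c1 * c3 + c2 * c4)
    \<le> 14 + 6 * ((a1 + c1) * (a3 + c3) + (a2 + c2) * (a4 + c4))
      + 2 * (a1 * a2 + a2 * a3 + a3 * a4 + a4 * a1) + 4 * (a1 * c2 + a2 * c3 + a3 * c4 + a4 * c1)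
      + 4 * (c1 * a2 + c2 * a3 + c3 * a4 + c4 * a1) + 4 * (c1 * c2 + c2 * c3 + c3 * c4 + c4 * c1)"
  by (rule letter_codes_cases[OF assms(1)]; simp?;
      rule letter_codes_cases[OF assms(2)]; simp?;
      rule letter_codes_cases[OF assms(3)]; simp?;
      rule letter_codes_cases[OF assms(4)]; simp?)

lemma corners_around_C_le:
  assumes "(a1, c1) \<in> letter_codes" "(a2, c2) \<in> letter_codes" "(a3, c3) \<in> letter_codes"
    "(a4, c4) \<in> letter_codes" and "0 \<le> q1" "0 \<le> q2" "0 \<le> q3" "0 \<le> q4"
  shows "0 \<le> c1 * (1 + 3 * (q4 + q1)) + c2 * (1 + 3 * (q1 + q2))
      + c3 * (1 + 3 * (q2 + q3)) + c4 * (1 + 3 * (q3 + q4))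
      + 6 * (a1 * a2 + a2 * a3 + a3 * a4 + a4 * a1) + 2 * (c1 * c2 + c2 * c3 + c3 * c4 + c4 * c1)"
  by (insert assms(5-8), rule letter_codes_cases[OF assms(1)]; simp?;
      rule letter_codes_cases[OF assms(2)]; simp?;
      rule letter_codes_cases[OF assms(3)]; simp?;
      rule letter_codes_cases[OF assms(4)]; simp?)

lemma edges_around_C_le:
  assumes "(a1, c1) \<in> letter_codes" "(a2, c2) \<in> letter_codes" "(a3, c3) \<in> letter_codes"
    "(a4, c4) \<in> letter_codes"
  shows "6 * (c1 + c2 + c3 + c4) + 12 * (a1 * a3 + a2 * a4) + 4 * (c1 * c3 + c2 * c4)
    \<le> 16 + 2 * (a1 * a2 + a2 * a3 + a3 * a4 + a4 * a1) + 4 * (a1 * c2 + a2 * c3 + a3 * c4 + a4 * c1)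
      + 4 * (c1 * a2 + c2 * a3 + c3 * a4 + c4 * a1) + 4 * (c1 * c2 + c2 * c3 + c3 * c4 + c4 * c1)"
  by (rule letter_codes_cases[OF assms(1)]; simp?;
      rule letter_codes_cases[OF assms(2)]; simp?;
      rule letter_codes_cases[OF assms(3)]; simp?;
      rule letter_codes_cases[OF assms(4)]; simp?)

lemma central_triples_AABC_le:
  assumes "A \<noteq> C"
  shows "10 * central_triples (\<lambda>x y z. x = A \<and> y = A \<and> \<not> (z = A \<or> z = C)) z
    + 20 * central_triples (\<lambda>x y z. x = A \<and> \<not> (y = A \<or> y = C) \<and> z = C) z
    \<le> 36 + rotation_sum (AABC_balance A C) z"
proof -
  define a :: "int \<Rightarrow> int \<Rightarrow> int" where "a s t = of_bool (z s t = A)" for s t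
  define c :: "int \<Rightarrow> int \<Rightarrow> int" where "c s t = of_bool (z s t = C)" for s t
  have codes: "(a s t, c s t) \<in> letter_codes" for s t
    using assms by (auto simp: a_def c_def letter_codes_def)
  have of_bool_B: "of_bool (\<not> (z s t = A \<or> z s t = C)) = 1 - a s t - c s t" for s t
    using assms by (auto simp: a_def c_def)
  have q_0_1: "a s t + c s t = 0 \<or> a s t + c s t = 1" and q_nonneg: "0 \<le> a s t + c s t" for s t
    using assms by (auto simp: a_def c_def)
  note corners = codes[of "-1" "-1"] codes[of "-1" 1] codes[of 1 1] codes[of 1 "-1"]
  note edges = codes[of "-1" 0] codes[of 0 1] codes[of 1 0] codes[of 0 "-1"]
  note q_edges = q_0_1[of "-1" 0] q_0_1[of 0 1] q_0_1[of 1 0] q_0_1[of 0 "-1"]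
  note q_edges_nonneg = q_nonneg[of "-1" 0] q_nonneg[of 0 1] q_nonneg[of 1 0] q_nonneg[of 0 "-1"]
  note indicators = central_triples_def rotation_sum_def AABC_balance_def Let_def
    of_bool_conj of_bool_B a_def[symmetric] c_def[symmetric] minus_minus minus_zero
  show ?thesis
  proof (rule letter_codes_cases[OF codes[of 0 0]])
    assume "a 0 0 = 0" "c 0 0 = 0"
    then show ?thesis
      unfolding indicators using corners_around_B_le[OF corners q_edges] edges_around_B_le[OF edges]
      by (simp add: algebra_simps)
  next
    assume "a 0 0 = 1" "c 0 0 = 0"
    then show ?thesis
      unfolding indicators
      using corners_around_A_le[OF corners q_edges_nonneg] edges_around_A_le[OF edges]
      by (simp add: algebra_simps)
  next
    assume "a 0 0 = 0" "c 0 0 = 1"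
    then show ?thesis
      unfolding indicators
      using corners_around_C_le[OF corners q_edges_nonneg] edges_around_C_le[OF edges]
      by (simp add: algebra_simps)
  qed
qed

lemma concentration_2_AABC_le:
  assumes "A \<noteq> B" "A \<noteq> C" "B \<noteq> C"
  shows "concentration 2 [A, A, B, C] \<le> 6 / 5"
proof (rule concentration_leI)
  fix n and \<Gamma> :: "(nat \<Rightarrow> int) \<Rightarrow> 'a" assume "discrete_torus 2 n"
  then interpret plane_torus n by (rule plane_torus.intro)
  let ?count = "int (card (appearances 2 n \<Gamma> [A, A, B, C]))" and ?T = "torus 2 n"
  let ?AAB = "\<lambda>x y z. x = A \<and> y = A \<and> \<not> (z = A \<or> z = C)"
  let ?ABC = "\<lambda>x y z. x = A \<and> \<not> (y = A \<or> y = C) \<and> z = C"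
  have "?count \<le> (\<Sum>p\<in>?T. central_triples ?AAB (window n \<Gamma> p))"
    by (rule card_appearances_le_central_triples[of 1]) (use assms in auto)
  moreover have "?count \<le> (\<Sum>p\<in>?T. central_triples ?ABC (window n \<Gamma> p))"
    by (rule card_appearances_le_central_triples[of 2]) (use assms in auto)
  ultimately have "30 * ?count \<le> (\<Sum>p\<in>?T. 10 * central_triples ?AAB (window n \<Gamma> p)
      + 20 * central_triples ?ABC (window n \<Gamma> p))"
    unfolding sum.distrib sum_distrib_left[symmetric] by linarith
  also have "\<dots> \<le> (\<Sum>p\<in>?T. 36 + rotation_sum (AABC_balance A C) (window n \<Gamma> p))"
    by (intro sum_mono central_triples_AABC_le assms(2))
  also have "\<dots> = 36 * int (card ?T)"
    by (simp add: sum.distrib sum_AABC_balance)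
  finally show "real (card (appearances 2 n \<Gamma> [A, A, B, C])) \<le> 6 / 5 * real (card ?T)"
    by linarith
qed

section \<open>One letter followed by copies of another\<close>

lemma spells_Cons_replicate:
  "spells f (A # replicate r B) \<longleftrightarrow> f 0 = A \<and> (\<forall>i. 0 < i \<and> i \<le> r \<longrightarrow> f i = B)"
proof
  assume spells: "spells f (A # replicate r B)"
  have "f i = B" if "0 < i" "i \<le> r" for i
    using spells_nth[OF spells, of i] that by (simp add: nth_Cons')
  then show "f 0 = A \<and> (\<forall>i. 0 < i \<and> i \<le> r \<longrightarrow> f i = B)"
    using spells_nth[OF spells, of 0] by simp
qed (auto simp: spells_def nth_Cons')

lemma Cons_replicate_no_period:
  assumes "A \<noteq> B" "0 < \<delta>" "\<delta> \<le> r"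
  shows "\<not> has_period (A # replicate r B) \<delta>"
proof
  assume "has_period (A # replicate r B) \<delta>"
  moreover have "0 + \<delta> < length (A # replicate r B)" using assms(3) by simp
  ultimately have "(A # replicate r B) ! 0 = (A # replicate r B) ! (0 + \<delta>)"
    unfolding has_period_def by blast
  then show False using assms by (simp add: nth_Cons')
qed

definition linear_form :: "nat \<Rightarrow> (nat \<Rightarrow> int) \<Rightarrow> (nat \<Rightarrow> int) \<Rightarrow> int" where
  "linear_form d a p = (\<Sum>j<d. a j * p j)"

lemma linear_form_axis_step: "k < d \<Longrightarrow> linear_form d a (axis_step x k) = a k * x"
  by (simp add: linear_form_def if_distrib[of "(*) _"] sum.delta cong: if_cong)

lemma dvd_linear_form_translate:
  "int m dvd linear_form d a (translate d (\<lambda>_. m) p u)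
    \<longleftrightarrow> int m dvd linear_form d a p + linear_form d a u"
proof -
  have "linear_form d a (translate d (\<lambda>_. m) p u) mod int m
      = (\<Sum>j<d. a j * ((p j + u j) mod int m) mod int m) mod int m"
    by (simp add: linear_form_def translate_def mod_sum_eq)
  also have "\<dots> = (\<Sum>j<d. a j * (p j + u j)) mod int m"
    unfolding mod_mult_right_eq by (rule mod_sum_eq)
  also have "\<dots> = (linear_form d a p + linear_form d a u) mod int m"
    by (simp add: linear_form_def distrib_left sum.distrib)
  finally show ?thesis by (simp add: dvd_eq_mod_eq_0)
qed

locale cubic_torus = discrete_torus d "\<lambda>_. m" for d m
begin

lemma dvd_linear_form_walk:
  "int m dvd linear_form d a (walk d (\<lambda>_. m) p v i)
    \<longleftrightarrow> int m dvd linear_form d a p + int i * linear_form d a v"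
proof -
  have "linear_form d a (\<lambda>j. int i * v j) = int i * linear_form d a v"
    by (simp add: linear_form_def sum_distrib_left mult.left_commute)
  then show ?thesis
    unfolding walk_eq_translate dvd_linear_form_translate by simp
qed

lemma card_torus_le_lattice:
  assumes "k < d" "a k = 1"
  shows "card (torus d (\<lambda>_. m)) \<le> m * card {p \<in> torus d (\<lambda>_. m). int m dvd linear_form d a p}"
proof -
  let ?T = "torus d (\<lambda>_. m)" and ?step = "\<lambda>p x. translate d (\<lambda>_. m) p (axis_step x k)"
  let ?hit = "\<lambda>p. of_bool (int m dvd linear_form d a p) :: nat"
  have "0 < m" using shape_pos[OF assms(1)] .
  have "1 \<le> (\<Sum>x\<in>{0..<int m}. ?hit (?step p x))" for p
  proof -
    let ?x = "- linear_form d a p mod int m"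
    have "int m dvd linear_form d a p + ?x"
      by (simp add: dvd_eq_mod_eq_0 mod_simps)
    then have "1 = ?hit (?step p ?x)"
      by (simp add: dvd_linear_form_translate linear_form_axis_step assms)
    also have "\<dots> \<le> (\<Sum>x\<in>{0..<int m}. ?hit (?step p x))"
      using \<open>0 < m\<close> by (intro member_le_sum[of ?x]) auto
    finally show ?thesis .
  qed
  then have "(\<Sum>p\<in>?T. 1) \<le> (\<Sum>p\<in>?T. \<Sum>x\<in>{0..<int m}. ?hit (?step p x))"
    by (intro sum_mono)
  also have "\<dots> = (\<Sum>x\<in>{0..<int m}. \<Sum>p\<in>?T. ?hit (?step p x))"
    by (rule sum.swap)
  also have "\<dots> = (\<Sum>x\<in>{0..<int m}. \<Sum>p\<in>?T. ?hit p)"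
    by (rule sum.cong[OF refl]) (rule sum_translate)
  finally show ?thesis by (simp add: finite_torus Int_def)
qed

lemma lattice_point_in_starts:
  assumes "r < m" "p \<in> torus d (\<lambda>_. m)"
    and in_lattice: "int m dvd linear_form d a p"
    and coprime: "coprime (int m) (linear_form d a v)"
  shows "p \<in> starts d (\<lambda>_. m) (\<lambda>q. if int m dvd linear_form d a q then A else B)
    (A # replicate r B) v"
proof -
  have "\<not> int m dvd linear_form d a (walk d (\<lambda>_. m) p v i)" if "0 < i" "i \<le> r" for i
  proof
    assume "int m dvd linear_form d a (walk d (\<lambda>_. m) p v i)"
    then have "int m dvd int i * linear_form d a v"
      using in_lattice by (simp add: dvd_linear_form_walk dvd_add_right_iff)
    then have "int m dvd int i"
      using coprime by (simp add: coprime_dvd_mult_left_iff)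
    then show False using that \<open>r < m\<close> by (simp add: nat_dvd_not_less)
  qed
  then show ?thesis
    using assms(2) in_lattice by (simp add: starts_def spells_Cons_replicate walk_0)
qed

end

lemma concentration_ge_lattice:
  assumes "r < m" "k < d" "a k = 1"
    and coprime: "\<And>v. v \<in> directions d \<Longrightarrow> coprime (int m) (linear_form d a v)"
  shows "real (card (directions d)) / real m \<le> concentration d (A # replicate r B)"
proof -
  let ?T = "torus d (\<lambda>_. m)" and ?L = "{p \<in> torus d (\<lambda>_. m). int m dvd linear_form d a p}"
  let ?\<Gamma> = "\<lambda>q. if int m dvd linear_form d a q then A else B"
  let ?App = "appearances d (\<lambda>_. m) ?\<Gamma> (A # replicate r B)"
  interpret cubic_torus d m using assms(1) by unfold_locales simp
  have "?L \<times> directions d \<subseteq> ?App"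
    using lattice_point_in_starts[OF assms(1) _ _ coprime] by (auto simp: mem_appearances)
  then have "card ?L * card (directions d) \<le> card ?App"
    unfolding card_cartesian_product[symmetric] by (intro card_mono finite_appearances)
  moreover have "card ?T * card (directions d) \<le> m * (card ?L * card (directions d))"
    unfolding mult.assoc[symmetric]
    by (intro mult_le_mono1 card_torus_le_lattice[of k a, OF assms(2,3)])
  ultimately have "card ?T * card (directions d) \<le> m * card ?App"
    by (meson mult_le_mono2 order_trans)
  then have "real (card ?T) * real (card (directions d)) \<le> real m * real (card ?App)"
    by (simp flip: of_nat_mult)
  then show ?thesis
    using assms(1)
    by (intro concentration_geI[OF discrete_torus_axioms, of _ ?\<Gamma>]) (simp add: field_simps)
qed

lemma concentration_2_ge_lattice:
  assumes "coprime m 6" "r < m"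
  shows "8 / real m \<le> concentration 2 (A # replicate r B)"
proof -
  have "coprime m (2 * 3)" using assms(1) by simp
  then have "coprime (int m) 2" "coprime (int m) 3"
    unfolding coprime_mult_right_iff by (metis coprime_int_iff of_nat_numeral)+
  moreover have "linear_form 2 (plane_vec 1 2) v = v 0 + 2 * v 1" for v
    by (simp add: linear_form_def lessThan_nat_numeral plane_vec_apply)
  then have "linear_form 2 (plane_vec 1 2) v \<in> {1, 2, 3, -1, -2, -3}" if "v \<in> directions 2" for v
    using that by (auto simp: directions_2 plane_vec_apply)
  ultimately have "coprime (int m) (linear_form 2 (plane_vec 1 2) v)" if "v \<in> directions 2" for v
    using that by fastforce
  then show ?thesis
    using concentration_ge_lattice[of r m 0 2 "plane_vec 1 2" A B] assms(2)
    by (simp add: card_directions_2 plane_vec_apply)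
qed

text \<open>No modulus is coprime to 6 and lies between 8 and 32/3, so length 8 needs its own grid. It
  has one \<open>A\<close> per row and column, placed such that 56 of the 64 pairs of an \<open>A\<close> and a direction
  are appearances.\<close>

definition eight_queens :: "int list" where
  "eight_queens = [2, 5, 1, 6, 4, 7, 3, 0]"

definition queen_grid :: "'a \<Rightarrow> 'a \<Rightarrow> (nat \<Rightarrow> int) \<Rightarrow> 'a" where
  "queen_grid A B p = (if p 1 = eight_queens ! nat (p 0) then A else B)"

definition queen_free :: "int \<times> int \<times> int \<Rightarrow> bool" where
  "queen_free = (\<lambda>(x, a, b). list_all (\<lambda>i. (eight_queens ! nat x + i * b) mod 8 \<noteq>
     eight_queens ! nat ((x + i * a) mod 8)) [1, 2, 3, 4, 5, 6, 7])"

definition queen_rays :: "(int \<times> int \<times> int) list" where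
  "queen_rays = filter queen_free (List.product [0, 1, 2, 3, 4, 5, 6, 7]
     [(1, 1), (1, 0), (-1, 1), (0, 1), (-1, -1), (-1, 0), (1, -1), (0, -1)])"

lemma card_queen_rays: "card (set queen_rays) = 56"
proof -
  have "distinct queen_rays"
    unfolding queen_rays_def by (intro distinct_filter distinct_product) auto
  moreover have "length queen_rays = 56" by code_simp
  ultimately show ?thesis by (simp add: distinct_card)
qed

lemma queen_ray_appears:
  assumes "(x, a, b) \<in> set queen_rays"
  shows "(plane_vec x (eight_queens ! nat x), plane_vec a b)
    \<in> appearances 2 (\<lambda>_. 8) (queen_grid A B) (A # replicate 7 B)"
proof -
  let ?y = "eight_queens ! nat x" let ?p = "plane_vec x ?y"
  interpret discrete_torus 2 "\<lambda>_. 8" by unfold_locales simp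
  have column: "x \<in> {0, 1, 2, 3, 4, 5, 6, 7}" and direction: "plane_vec a b \<in> directions 2"
    and free: "queen_free (x, a, b)"
    using assms unfolding queen_rays_def set_filter List.set_product by (auto simp: directions_2)
  have "?y \<in> {0..<8}" using column by (auto simp: eight_queens_def)
  then have p_in_torus: "?p \<in> torus 2 (\<lambda>_. 8)"
    using column by (auto simp: torus_def plane_vec_def less_2_cases_iff)
  have "queen_grid A B (walk 2 (\<lambda>_. 8) ?p (plane_vec a b) i) = B" if "0 < i" "i \<le> 7" for i
  proof -
    have "int i \<in> set [1, 2, 3, 4, 5, 6, 7]" using that by auto
    then have "(?y + int i * b) mod 8 \<noteq> eight_queens ! nat ((x + int i * a) mod 8)"
      using free unfolding queen_free_def list_all_iff by blast
    then show ?thesis by (simp add: queen_grid_def walk_def plane_vec_apply)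
  qed
  moreover have "queen_grid A B ?p = A" by (simp add: queen_grid_def plane_vec_apply)
  ultimately show ?thesis
    using p_in_torus direction
    by (simp add: mem_appearances starts_def spells_Cons_replicate walk_0)
qed

lemma concentration_2_ge_queens: "7 / 8 \<le> concentration 2 (A # replicate 7 B)"
proof (rule concentration_geI)
  let ?App = "appearances 2 (\<lambda>_. 8) (queen_grid A B) (A # replicate 7 B)"
  let ?ray = "\<lambda>(x, a, b). (plane_vec x (eight_queens ! nat x), plane_vec a b)"
  have "card (set queen_rays) \<le> card ?App"
  proof (rule card_inj_on_le[OF _ _ finite_appearances])
    show "inj_on ?ray (set queen_rays)" by (auto simp: inj_on_def plane_vec_eq_iff)
    show "?ray ` set queen_rays \<subseteq> ?App" using queen_ray_appears by auto
  qed
  then show "7 / 8 * real (card (torus 2 (\<lambda>_. 8))) \<le> real (card ?App)"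
    by (simp add: card_queen_rays card_torus)
qed (simp add: discrete_torus_def)

lemma ex_coprime_6_between:
  assumes "3 < l" "l \<noteq> 8"
  obtains m :: nat where "coprime m 6" "l \<le> m" "3 * m < 4 * l"
proof -
  have "\<exists>r. ((l + r) mod 6 = 1 \<or> (l + r) mod 6 = 5) \<and> 3 * r < l"
    using assms by presburger
  then obtain r where residue: "(l + r) mod 6 = 1 \<or> (l + r) mod 6 = 5" and small: "3 * r < l"
    by blast
  have "gcd (l + r) 6 = gcd 6 ((l + r) mod 6)" by (rule gcd_red_nat)
  also have "\<dots> = 1" using residue by (auto simp: gcd_non_0_nat)
  finally show ?thesis using that[of "l + r"] small by (simp add: coprime_iff_gcd_eq_1)
qed

lemma concentration_2_Cons_replicate_gt:
  assumes "2 < r"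
  shows "6 / real (Suc r) < concentration 2 (A # replicate r B)"
proof (cases "r = 7")
  case True
  then show ?thesis using concentration_2_ge_queens[of A B] by simp
next
  case False
  obtain m where coprime: "coprime m 6" and bounds: "Suc r \<le> m" "3 * m < 4 * Suc r"
    using ex_coprime_6_between[of "Suc r"] assms False by auto
  have "6 / real (Suc r) < 8 / real m" using bounds by (simp add: field_simps)
  also have "\<dots> \<le> concentration 2 (A # replicate r B)"
    using coprime bounds(1) by (intro concentration_2_ge_lattice) auto
  finally show ?thesis .
qed

lemma not_stackable_2_Cons_replicate:
  assumes "2 < r" "A \<noteq> B"
  shows "\<not> stackable 2 (A # replicate r B)"
proof -
  have "concentration 1 (A # replicate r B) \<le> 2 / real (Suc r)"
    using concentration_le_if_no_period[of "Suc r" "A # replicate r B" 1]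
      Cons_replicate_no_period[OF assms(2)]
    by (simp add: card_directions_1 less_Suc_eq_le del: One_nat_def)
  then show ?thesis
    using concentration_2_Cons_replicate_gt[OF assms(1), of A B] by (simp add: stackable_def)
qed

section \<open>Words of length at most four\<close>

lemma stackable_2_if_cyclic_word:
  assumes upper: "concentration 2 w \<le> 6 / real (length u)"
    and "x \<in> cyclic_hits (length u) ((!) u) w" "y \<in> cyclic_hits (length u) ((!) u) (rev w)"
  shows "stackable 2 w"
proof -
  have "0 < length u" using assms(2) by (auto simp: cyclic_hits_def)
  have "0 < card (cyclic_hits (length u) ((!) u) w)"
    "0 < card (cyclic_hits (length u) ((!) u) (rev w))"
    using assms(2,3) by (auto simp: card_gt_0_iff finite_cyclic_hits)
  then have "2 \<le> concentration 1 w * real (length u)"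
    using cyclic_hits_le_concentration[OF zero_less_one \<open>0 < length u\<close>, of "(!) u" w] by simp
  then have "6 / real (length u) \<le> 3 * concentration 1 w"
    using \<open>0 < length u\<close> by (simp add: field_simps)
  then show ?thesis using upper by (simp add: stackable_iff_le)
qed

lemma stackable_2_AAB:
  assumes "A \<noteq> B"
  shows "stackable 2 [A, A, B]"
proof (rule stackable_2_if_cyclic_word[where u = "[A, A, B]" and x = 0 and y = 2])
  show "concentration 2 [A, A, B] \<le> 6 / real (length [A, A, B])"
    using concentration_2_AAB_le[OF assms] by simp
qed (simp_all add: cyclic_hits_def spells_def All_less_Suc)

lemma stackable_2_AABA:
  assumes "A \<noteq> B"
  shows "stackable 2 [A, A, B, A]"
proof (rule stackable_2_if_cyclic_word[where u = "[A, A, B]" and x = 0 and y = 1])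
  show "concentration 2 [A, A, B, A] \<le> 6 / real (length [A, A, B])"
    using concentration_2_AAB_le[OF assms]
      concentration_append_le[of 2 "[A, A, B]" "[A]"] by simp
qed (simp_all add: cyclic_hits_def spells_def All_less_Suc)

lemma concentration_2_ABBA_le:
  assumes "A \<noteq> B"
  shows "concentration 2 [A, B, B, A] \<le> 2"
  using concentration_2_AAB_le[of B A] assms concentration_append_le[of 2 "[A, B, B]" "[A]"]
    concentration_rev[of 2 "[A, B, B]"] by simp

lemma stackable_2_ABBA:
  assumes "A \<noteq> B"
  shows "stackable 2 [A, B, B, A]"
proof (rule stackable_2_if_cyclic_word[where u = "[A, B, B]" and x = 0 and y = 0])
  show "concentration 2 [A, B, B, A] \<le> 6 / real (length [A, B, B])"
    using concentration_2_ABBA_le[OF assms] by simp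
qed (simp_all add: cyclic_hits_def spells_def All_less_Suc)

lemma stackable_2_ABBC:
  assumes "A \<noteq> B" "A \<noteq> C" "B \<noteq> C"
  shows "stackable 2 [A, B, B, C]"
proof (rule stackable_2_if_cyclic_word[where u = "[A, B, B, C, B, B]" and x = 0 and y = 3])
  show "concentration 2 [A, B, B, C] \<le> 6 / real (length [A, B, B, C, B, B])"
    using concentration_map_palindrome[of "id(C := A)" "[A, B, B, C]" 2]
      concentration_2_ABBA_le[of A B] assms by simp
qed (simp_all add: cyclic_hits_def spells_def All_less_Suc)

lemma stackable_2_ABCA:
  assumes "A \<noteq> B" "A \<noteq> C" "B \<noteq> C"
  shows "stackable 2 [A, B, C, A]"
proof (rule stackable_2_if_cyclic_word[where u = "[A, B, C, A, C, B]" and x = 0 and y = 3])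
  show "concentration 2 [A, B, C, A] \<le> 6 / real (length [A, B, C, A, C, B])"
    using concentration_map_palindrome[of "id(C := B)" "[A, B, C, A]" 2]
      concentration_2_ABBA_le[of A B] assms by simp
qed (simp_all add: cyclic_hits_def spells_def All_less_Suc)

lemma stackable_2_AABC:
  assumes "A \<noteq> B" "A \<noteq> C" "B \<noteq> C"
  shows "stackable 2 [A, A, B, C]"
proof (rule stackable_2_if_cyclic_word[where u = "[A, A, B, C, B]" and x = 0 and y = 3])
  show "concentration 2 [A, A, B, C] \<le> 6 / real (length [A, A, B, C, B])"
    using concentration_2_AABC_le[OF assms] by simp
qed (simp_all add: cyclic_hits_def spells_def All_less_Suc)

lemma stackable_2_AABB:
  assumes "A \<noteq> B"
  shows "stackable 2 [A, A, B, B]"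
proof -
  have "is_word [A, B]" "parity_separated [A, B]"
    using assms by (auto simp: is_word_def parity_separated_def less_Suc_eq)
  then have "stackable 2 (repeat_letters 2 [A, B])"
    by (intro stackable_repeat_letters stackable_if_parity_separated) auto
  then show ?thesis by (simp add: repeat_letters_def numeral_2_eq_2)
qed

lemma stackable_2_double_first:
  assumes "A \<noteq> B"
  shows "stackable 2 [A, A, B, C]"
  using stackable_2_AABA[OF assms] stackable_2_AABB[OF assms] stackable_2_AABC[OF assms, of C]
  by (cases "C = A"; cases "C = B") auto

lemma stackable_2_double_last:
  assumes "A \<noteq> B"
  shows "stackable 2 [C, B, A, A]"
  using stackable_2_double_first[OF assms, of C] stackable_rev[of 2 "[A, A, B, C]"] by simp

lemma stackable_2_double_middle:
  assumes "A \<noteq> B" "C \<noteq> B"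
  shows "stackable 2 [A, B, B, C]"
  using assms stackable_2_ABBA[of A B] stackable_2_ABBC[of A B C] by (cases "C = A") auto

lemma stackable_2_length_3:
  assumes "is_word [a, b, c]"
  shows "stackable 2 [a, b, c]"
proof -
  consider "a = b" "b \<noteq> c" | "a \<noteq> b" "b = c" | "a \<noteq> b" "b \<noteq> c"
    using assms by (auto simp: is_word_def)
  then show ?thesis
  proof cases
    case 1
    then show ?thesis using stackable_2_AAB[of b c] by simp
  next
    case 2
    then show ?thesis using stackable_2_AAB[of b a] stackable_rev[of 2 "[a, b, b]"] by simp
  next
    case 3
    then have "parity_separated [a, b, c]" by (auto simp: parity_separated_def less_Suc_eq)
    then show ?thesis using assms by (intro stackable_if_parity_separated) auto
  qed
qed

lemma stackable_2_length_4:
  assumes "is_word [a, b, c, e]" and "\<not> (b = c \<and> (a = b \<or> c = e))"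
  shows "stackable 2 [a, b, c, e]"
proof -
  consider "a = b" "b \<noteq> c" | "c = e" "b \<noteq> c" | "b = c" "a \<noteq> b" "c \<noteq> e"
    | "a \<noteq> b" "b \<noteq> c" "c \<noteq> e" "a = e" | "a \<noteq> b" "b \<noteq> c" "c \<noteq> e" "a \<noteq> e"
    using assms(2) by blast
  then show ?thesis
  proof cases
    case 1
    then show ?thesis using stackable_2_double_first[of b c e] by simp
  next
    case 2
    then show ?thesis using stackable_2_double_last[of e b a] by simp
  next
    case 3
    then show ?thesis using stackable_2_double_middle[of a b e] by simp
  next
    case 4
    then show ?thesis using stackable_2_ABCA[of a b c] by auto
  next
    case 5
    then have "parity_separated [a, b, c, e]" by (auto simp: parity_separated_def less_Suc_eq)
    then show ?thesis using assms(1) by (intro stackable_if_parity_separated) auto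
  qed
qed

lemma not_stackable_2_ABBB:
  assumes "A \<noteq> B"
  shows "\<not> stackable 2 [A, B, B, B]" "\<not> stackable 2 [B, B, B, A]"
proof -
  show not_ABBB: "\<not> stackable 2 [A, B, B, B]"
    using not_stackable_2_Cons_replicate[of 3 A B] assms by (simp add: numeral_3_eq_3)
  then show "\<not> stackable 2 [B, B, B, A]"
    using stackable_rev[of 2 "[A, B, B, B]"] by simp
qed

lemma stackable_2_length_le_4_iff:
  assumes word: "is_word w" and short: "length w \<le> 4"
  shows "stackable 2 w \<longleftrightarrow> \<not> (\<exists>A B. A \<noteq> B \<and> (w = [A, B, B, B] \<or> w = [B, B, B, A]))"
proof
  show "\<not> (\<exists>A B. A \<noteq> B \<and> (w = [A, B, B, B] \<or> w = [B, B, B, A]))" if "stackable 2 w"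
    using that by (auto simp: not_stackable_2_ABBB)
next
  assume not_ABBB: "\<not> (\<exists>A B. A \<noteq> B \<and> (w = [A, B, B, B] \<or> w = [B, B, B, A]))"
  consider a b where "w = [a, b]" | a b c where "w = [a, b, c]" | a b c e where "w = [a, b, c, e]"
  proof -
    have "length w = 2 \<or> length w = 3 \<or> length w = 4"
      using is_word_length[OF word] short by linarith
    then show ?thesis using that by (auto simp: length_Suc_conv eval_nat_numeral)
  qed
  then show "stackable 2 w"
  proof cases
    case (1 a b)
    then have "parity_separated w"
      using word by (auto simp: is_word_def parity_separated_def less_Suc_eq)
    then show ?thesis by (intro stackable_if_parity_separated word) auto
  next
    case (2 a b c)
    then show ?thesis using word by (simp add: stackable_2_length_3)
  next
    case (3 a b c e)
    then have "\<not> (b = c \<and> (a = b \<or> c = e))" using not_ABBB word by (auto simp: is_word_def)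
    then show ?thesis using word 3 by (simp add: stackable_2_length_4)
  qed
qed

theorem theorem1p4:
  shows
    "(\<forall>w :: 'a list. is_word w \<longrightarrow>
        (\<forall>i<length w. \<forall>j<length w. odd i \<and> even j \<longrightarrow> w ! i \<noteq> w ! j) \<longrightarrow>
        (\<forall>d\<ge>1. stackable d w))
     \<and> (\<forall>(w :: 'a list) d k. is_word w \<longrightarrow> d \<ge> 1 \<longrightarrow> k \<ge> 1 \<longrightarrow> stackable d w \<longrightarrow>
          stackable d (repeat_letters k w))
     \<and> (\<forall>w :: 'a list. is_word w \<longrightarrow> length w \<le> 4 \<longrightarrow>
          (stackable 2 w \<longleftrightarrow>
            \<not> (\<exists>A B. A \<noteq> B \<and> (w = [A, B, B, B] \<or> w = [B, B, B, A]))))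
     \<and> (\<forall>(l::nat) (A::'a) B. l > 3 \<longrightarrow> A \<noteq> B \<longrightarrow>
          \<not> stackable 2 (A # replicate (l - 1) B))"
proof (intro conjI allI impI)
  fix w :: "'a list" and d :: nat
  assume "is_word w" "\<forall>i<length w. \<forall>j<length w. odd i \<and> even j \<longrightarrow> w ! i \<noteq> w ! j" "1 \<le> d"
  then show "stackable d w"
    by (intro stackable_if_parity_separated) (auto simp: parity_separated_def)
next
  fix w :: "'a list" and d k :: nat
  assume "is_word w" "1 \<le> d" "1 \<le> k" "stackable d w"
  then show "stackable d (repeat_letters k w)" by (intro stackable_repeat_letters) auto
next
  fix w :: "'a list"
  assume "is_word w" "length w \<le> 4"
  then show "stackable 2 w \<longleftrightarrow> \<not> (\<exists>A B. A \<noteq> B \<and> (w = [A, B, B, B] \<or> w = [B, B, B, A]))"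
    by (rule stackable_2_length_le_4_iff)
next
  fix l :: nat and A B :: 'a
  assume "3 < l" "A \<noteq> B"
  then show "\<not> stackable 2 (A # replicate (l - 1) B)"
    by (intro not_stackable_2_Cons_replicate) auto
qed

end
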